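(* Let $\kappa_*>0$ and let $H^*$ be a probability measure on $(0,\infty)$. Let $X_1,X_2,\dots$ be i.i.d. from $X_i\mid\theta_i\sim\mathrm{Poi}(\theta_i)$, $\theta_i\mid\lambda_i\sim\mathrm{Gamma}(\kappa_*,\lambda_i)$ (shape-rate), $\lambda_i\sim H^*$, with cumulative distribution function $F^*$ on $\mathbb Z_+$, and let $\mathbb F_n$ be the empirical distribution function of $X_1,\dots,X_n$. Let $\kappa_0=\inf\{\kappa>0:g_{H^*,\kappa_*}\in\mathcal G_\kappa\}$. For a positive sequence $\eta_n$, define $$\hat\kappa_0=\inf\{\kappa>0:\delta_n(\kappa)\le\eta_n\},\qquad\delta_n(\kappa)=\inf_{H\in\mathcal P((0,\infty))}d_{\mathrm{KS}}(F_{H,\kappa},\mathbb F_n).$$ Suppose $\eta_n\to0$ and, almost surely, $d_{\mathrm{KS}}(\mathbb F_n,F^* )\le\eta_n$ for all sufficiently large $n$. Then $\hat\kappa_0\to\kappa_0$ almost surely. In particular, if $\eta_n=C\sqrt{(\log n)/n}$ for some $C>1/\sqrt2$, then $\hat\kappa_0\to\kappa_0$ almost surely as $n\to\infty$.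
   Context: For $\kappa>0$ and $H\in\mathcal P((0,\infty))$ (probability measures on $(0,\infty)$): $g_{H,\kappa}(\theta)=\int\frac{\lambda^\kappa}{\Gamma(\kappa)}\theta^{\kappa-1}e^{-\lambda\theta}dH(\lambda)$ for $\theta>0$, and $\mathcal G_\kappa=\{g_{H,\kappa}:H\in\mathcal P((0,\infty))\}$; thus $g_{H^*,\kappa_*}$ is the density of $\theta_i$. $f_{H,\kappa}(x)=\int\frac{\Gamma(x+\kappa)}{x!\,\Gamma(\kappa)}\left(\frac{1}{\lambda+1}\right)^x\left(\frac{\lambda}{\lambda+1}\right)^{\kappa}dH(\lambda)$ for $x\in\mathbb Z_+$, and $F_{H,\kappa}(m)=\sum_{x=0}^m f_{H,\kappa}(x)$. The Kolmogorov–Smirnov distance is $d_{\mathrm{KS}}(F_1,F_2)=\sup_{m\in\mathbb Z_+}|F_1(m)-F_2(m)|$. *)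

theory Defs
  imports "HOL-Probability.Probability"
begin

definition Ppos :: "real measure set" where
  "Ppos = {H. prob_space H \<and> sets H = sets borel \<and> (AE x in H. 0 < x)}"

definition gamma_dens :: "real \<Rightarrow> real \<Rightarrow> real \<Rightarrow> real" where
  "gamma_dens \<kappa> lam \<theta> =
     (if 0 < \<theta> then lam powr \<kappa> / Gamma \<kappa> * \<theta> powr (\<kappa> - 1) * exp (- lam * \<theta>) else 0)"

definition gmix :: "real measure \<Rightarrow> real \<Rightarrow> real \<Rightarrow> real" where
  "gmix H \<kappa> \<theta> = (\<integral>lam. gamma_dens \<kappa> lam \<theta> \<partial>H)"

definition inG :: "real \<Rightarrow> (real \<Rightarrow> real) \<Rightarrow> bool" where
  "inG \<kappa> g \<longleftrightarrow> (\<exists>H\<in>Ppos. \<forall>\<theta>>0. g \<theta> = gmix H \<kappa> \<theta>)"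

definition fmix :: "real measure \<Rightarrow> real \<Rightarrow> nat \<Rightarrow> real" where
  "fmix H \<kappa> x = (\<integral>lam. Gamma (real x + \<kappa>) / (fact x * Gamma \<kappa>)
        * (1 / (lam + 1)) ^ x * (lam / (lam + 1)) powr \<kappa> \<partial>H)"

definition Fmix :: "real measure \<Rightarrow> real \<Rightarrow> nat \<Rightarrow> real" where
  "Fmix H \<kappa> m = (\<Sum>x\<le>m. fmix H \<kappa> x)"

definition dKS :: "(nat \<Rightarrow> real) \<Rightarrow> (nat \<Rightarrow> real) \<Rightarrow> real" where
  "dKS F1 F2 = (SUP m. \<bar>F1 m - F2 m\<bar>)"

text \<open>Empirical CDF of X_1,...,X_n (here indexed X 0, ..., X (n-1)).\<close>
definition empF :: "(nat \<Rightarrow> 'a \<Rightarrow> nat) \<Rightarrow> nat \<Rightarrow> 'a \<Rightarrow> nat \<Rightarrow> real" where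
  "empF X n \<omega> m = real (card {i. i < n \<and> X i \<omega> \<le> m}) / real n"

definition delta_n :: "(nat \<Rightarrow> real) \<Rightarrow> real \<Rightarrow> real" where
  "delta_n Fe \<kappa> = (INF H\<in>Ppos. dKS (Fmix H \<kappa>) Fe)"

definition kappa_hat :: "(nat \<Rightarrow> real) \<Rightarrow> (nat \<Rightarrow> 'a \<Rightarrow> nat) \<Rightarrow> nat \<Rightarrow> 'a \<Rightarrow> real" where
  "kappa_hat \<eta> X n \<omega> = Inf {\<kappa>. 0 < \<kappa> \<and> delta_n (empF X n \<omega>) \<kappa> \<le> \<eta> n}"

definition kappa0 :: "real measure \<Rightarrow> real \<Rightarrow> real" where
  "kappa0 Hs \<kappa>s = Inf {\<kappa>. 0 < \<kappa> \<and> inG \<kappa> (gmix Hs \<kappa>s)}"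

end

theory Submission
  imports Defs "HOL-Complex_Analysis.Complex_Analysis" "HOL-Real_Asymp.Real_Asymp"
begin

text \<open>
  The Laplace transform of the Gamma mixture at \<open>u\<close> is \<open>\<integral> (\<lambda> / (\<lambda> + u))\<^sup>\<kappa> dH\<close>, and for
  \<open>0 < u \<le> 1\<close> it equals the probability generating function of \<open>f\<^bsub>H,\<kappa>\<^esub>\<close> at \<open>1 - u\<close>; by Abel
  summation two such transforms differ there by at most the Kolmogorov--Smirnov distance. If
  shapes \<open>\<kappa>\<^sub>j \<le> K\<close> and mixing measures \<open>H\<^sub>j\<close> brought that distance to \<open>F\<^sup>*\<close> down to \<open>0\<close>, then
  after compactifying the rates by \<open>y = \<lambda> / (1 + \<lambda>)\<close> a subsequence would converge to a mixture
  whose transform agrees with that of \<open>\<theta>\<close> on \<open>(0, 1]\<close>. Shapes tending to \<open>0\<close> are impossible,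
  since then the limit transform would be constant; \<open>u \<rightarrow> 0\<close> excludes mass at \<open>y = 0\<close>;
  uniqueness of Laplace transforms excludes an atom of \<open>\<theta>\<close> at \<open>0\<close>, hence mass at \<open>y = 1\<close>, and
  identifies the densities. So \<open>g \<in> \<G>\<^sub>\<kappa>\<close> for some \<open>\<kappa> \<le> K\<close>, which is false for \<open>K < \<kappa>\<^sub>0\<close>: shapes
  below \<open>K\<close> stay at a positive distance from \<open>F\<^sup>*\<close> and are eventually rejected, while every
  admissible shape is eventually accepted.
\<close>

section \<open>Gamma and negative binomial mixtures\<close>

text \<open>Substitute t = b\<theta> in Euler's integral. The extended nonnegative form lets
  integrals be exchanged later without integrability proofs.\<close>

lemma nn_integral_Gamma_scaled:
  fixes a b :: real
  assumes "0 < a" "0 < b"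
  shows "(\<integral>\<^sup>+\<theta>. ennreal (if 0 < \<theta> then \<theta> powr (a - 1) * exp (- b * \<theta>) else 0) \<partial>lborel)
      = ennreal (Gamma a / b powr a)"
proof -
  have "Gamma a = (\<integral>\<^sup>+t. ennreal (indicator {0..} t * t powr (a - 1) / exp t) \<partial>lborel)"
    using assms by (simp add: Gamma_conv_nn_integral_real)
  also have "\<dots> = b * (\<integral>\<^sup>+t. ennreal (indicator {0..} (b * t) * (b * t) powr (a - 1) / exp (b * t)) \<partial>lborel)"
    using assms nn_integral_real_affine[where t = 0 and c = b and f = "\<lambda>t. ennreal (indicator {0..} t * t powr (a - 1) / exp t)"]
    by simp
  also have "\<dots> = b * (\<integral>\<^sup>+t. ennreal (b powr (a - 1)) *
       ennreal (if 0 < t then t powr (a - 1) * exp (- b * t) else 0) \<partial>lborel)"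
    using assms
    by (intro arg_cong[where f = "(*) (ennreal b)"] nn_integral_cong, subst ennreal_mult[symmetric])
      (auto simp: indicator_def zero_le_mult_iff powr_mult exp_minus field_simps intro!: arg_cong[where f = ennreal])
  also have "\<dots> = ennreal b * ennreal (b powr (a - 1)) *
      (\<integral>\<^sup>+t. ennreal (if 0 < t then t powr (a - 1) * exp (- b * t) else 0) \<partial>lborel)"
    by (subst nn_integral_cmult) (auto simp: mult.assoc)
  also have "ennreal b * ennreal (b powr (a - 1)) = ennreal (b powr a)"
    using assms by (simp add: ennreal_mult[symmetric] powr_mult_base)
  finally have *: "ennreal (Gamma a) = ennreal (b powr a) *
      (\<integral>\<^sup>+t. ennreal (if 0 < t then t powr (a - 1) * exp (- b * t) else 0) \<partial>lborel)" (is "_ = _ * ?I") .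
  have "ennreal (1 / b powr a) * ennreal (Gamma a) = ennreal (1 / b powr a) * ennreal (b powr a) * ?I"
    unfolding * by (simp add: mult.assoc)
  also have "ennreal (1 / b powr a) * ennreal (b powr a) = 1"
    using assms by (simp add: ennreal_mult[symmetric])
  finally show ?thesis
    using assms by (simp add: ennreal_mult[symmetric])
qed

lemma gamma_dens_nonneg [simp]: "0 < \<kappa> \<Longrightarrow> 0 \<le> gamma_dens \<kappa> l \<theta>"
  by (auto simp: gamma_dens_def intro!: mult_nonneg_nonneg divide_nonneg_nonneg Gamma_real_nonneg)

lemma measurable_gamma_dens [measurable (raw)]:
  assumes [measurable]: "f \<in> borel_measurable M" "g \<in> borel_measurable M"
  shows "(\<lambda>x. gamma_dens \<kappa> (f x) (g x)) \<in> borel_measurable M"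
  unfolding gamma_dens_def by measurable

text \<open>One computation for two purposes: x = 0 yields the Laplace transform of a Gamma density,
  u = 1 the Poisson probabilities averaged over a Gamma density.\<close>

lemma nn_integral_gamma_dens:
  fixes \<kappa> l u :: real and x :: nat
  assumes "0 < \<kappa>" "0 < l" "0 \<le> u"
  shows "(\<integral>\<^sup>+\<theta>. ennreal (gamma_dens \<kappa> l \<theta> * (exp (- u * \<theta>) * \<theta> ^ x / fact x)) \<partial>lborel)
      = ennreal (Gamma (real x + \<kappa>) / (fact x * Gamma \<kappa>) * (1 / (l + u)) ^ x * (l / (l + u)) powr \<kappa>)"
proof -
  have "(\<integral>\<^sup>+\<theta>. ennreal (gamma_dens \<kappa> l \<theta> * (exp (- u * \<theta>) * \<theta> ^ x / fact x)) \<partial>lborel)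
     = (\<integral>\<^sup>+\<theta>. ennreal (l powr \<kappa> / (fact x * Gamma \<kappa>)) *
         ennreal (if 0 < \<theta> then \<theta> powr ((real x + \<kappa>) - 1) * exp (- (l + u) * \<theta>) else 0) \<partial>lborel)"
    using assms
    by (intro nn_integral_cong, subst ennreal_mult[symmetric])
      (auto simp: gamma_dens_def powr_add powr_diff powr_realpow exp_add[symmetric] field_simps
        intro!: arg_cong[where f = ennreal] divide_nonneg_nonneg mult_nonneg_nonneg Gamma_real_nonneg)
  also have "\<dots> = ennreal (l powr \<kappa> / (fact x * Gamma \<kappa>)) * ennreal (Gamma (real x + \<kappa>) / (l + u) powr (real x + \<kappa>))"
    using assms by (subst nn_integral_cmult) (simp_all add: nn_integral_Gamma_scaled)
  also have "\<dots> = ennreal (Gamma (real x + \<kappa>) / (fact x * Gamma \<kappa>) * (1 / (l + u)) ^ x * (l / (l + u)) powr \<kappa>)"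
    using assms by (subst ennreal_mult[symmetric])
      (auto simp: powr_add powr_divide powr_realpow power_divide mult_ac intro!: divide_nonneg_nonneg mult_nonneg_nonneg Gamma_real_nonneg)
  finally show ?thesis .
qed

definition lap :: "real \<Rightarrow> real measure \<Rightarrow> real \<Rightarrow> real" where
  "lap \<kappa> H u = (\<integral>l. (l / (l + u)) powr \<kappa> \<partial>H)"

text \<open>The right-hand side is the maximum, attained at x = \<kappa>; the bound is ln y \<le> y
  - 1 at y = x / \<kappa>.\<close>

lemma powr_times_exp_le:
  fixes x \<kappa> :: real
  assumes "0 < x" "0 < \<kappa>"
  shows "x powr \<kappa> * exp (- x) \<le> exp (\<kappa> * ln \<kappa> - \<kappa>)"
proof -
  have "ln (x / \<kappa>) \<le> x / \<kappa> - 1" using assms by (intro ln_le_minus_one) auto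
  then have "\<kappa> * (ln x - ln \<kappa>) \<le> \<kappa> * (x / \<kappa> - 1)"
    using assms by (intro mult_left_mono) (auto simp: ln_div)
  also have "\<kappa> * (x / \<kappa> - 1) = x - \<kappa>"
    using assms by (simp add: right_diff_distrib)
  finally have "\<kappa> * ln x - x \<le> \<kappa> * ln \<kappa> - \<kappa>"
    by (simp add: right_diff_distrib)
  then show ?thesis
    using assms by (simp add: powr_def exp_add[symmetric])
qed

text \<open>The bound is uniform in the rate, so it makes the density integrable against every
  mixing measure and dominates it when \<theta> varies.\<close>

lemma gamma_dens_le:
  assumes "0 < \<kappa>" "0 < l" "0 < \<theta>"
  shows "gamma_dens \<kappa> l \<theta> \<le> exp (\<kappa> * ln \<kappa> - \<kappa>) / (Gamma \<kappa> * \<theta>)"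
proof -
  have "gamma_dens \<kappa> l \<theta> = ((l * \<theta>) powr \<kappa> * exp (- (l * \<theta>))) / (Gamma \<kappa> * \<theta>)"
    using assms by (simp add: gamma_dens_def powr_mult powr_diff)
  also have "\<dots> \<le> exp (\<kappa> * ln \<kappa> - \<kappa>) / (Gamma \<kappa> * \<theta>)"
    using assms by (intro divide_right_mono powr_times_exp_le) (auto intro!: mult_nonneg_nonneg Gamma_real_nonneg)
  finally show ?thesis .
qed

lemma PposD:
  assumes "H \<in> Ppos"
  shows "prob_space H" "sets H = sets borel" "AE x in H. 0 < x" "space H = UNIV"
  using assms sets_eq_imp_space_eq[of H borel] by (auto simp: Ppos_def)

lemma integrable_Ppos_bounded:
  fixes f :: "real \<Rightarrow> real"
  assumes H: "H \<in> Ppos" and [measurable]: "f \<in> borel_measurable borel"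
    and "\<And>l. 0 < l \<Longrightarrow> \<bar>f l\<bar> \<le> B"
  shows "integrable H f"
proof -
  interpret prob_space H using PposD(1)[OF H] .
  note [measurable_cong] = PposD(2)[OF H]
  show ?thesis
    using PposD(3)[OF H] assms(3)
    by (intro integrable_const_bound[where B = B]) auto
qed

lemma integrable_gamma_dens:
  assumes "H \<in> Ppos" "0 < \<kappa>"
  shows "integrable H (\<lambda>l. gamma_dens \<kappa> l \<theta>)"
proof (cases "0 < \<theta>")
  case True
  then show ?thesis
    using assms gamma_dens_le[of \<kappa> _ \<theta>]
    by (intro integrable_Ppos_bounded) auto
next
  case False
  then show ?thesis by (simp add: gamma_dens_def)
qed

lemma gmix_nonneg: "0 < \<kappa> \<Longrightarrow> 0 \<le> gmix H \<kappa> \<theta>"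
  unfolding gmix_def by (intro integral_nonneg_AE) auto

lemma gmix_eq_0: "\<theta> \<le> 0 \<Longrightarrow> gmix H \<kappa> \<theta> = 0"
  by (simp add: gmix_def gamma_dens_def)

lemma measurable_gmix [measurable]:
  assumes "H \<in> Ppos"
  shows "gmix H \<kappa> \<in> borel_measurable borel"
proof -
  interpret prob_space H using PposD(1)[OF assms] .
  note [measurable_cong] = PposD(2)[OF assms]
  show ?thesis unfolding gmix_def by measurable
qed

lemma nn_integral_gmix:
  assumes H: "H \<in> Ppos" and \<kappa>: "0 < \<kappa>" and [measurable]: "h \<in> borel_measurable borel"
    and h: "\<And>\<theta>. 0 < \<theta> \<Longrightarrow> 0 \<le> h \<theta>"
  shows "(\<integral>\<^sup>+\<theta>. ennreal (gmix H \<kappa> \<theta> * h \<theta>) \<partial>lborel)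
      = (\<integral>\<^sup>+l. (\<integral>\<^sup>+\<theta>. ennreal (gamma_dens \<kappa> l \<theta> * h \<theta>) \<partial>lborel) \<partial>H)"
proof -
  interpret prob_space H using PposD(1)[OF H] .
  interpret pair_sigma_finite H lborel ..
  note [measurable_cong] = PposD(2)[OF H]
  have "(\<integral>\<^sup>+\<theta>. ennreal (gmix H \<kappa> \<theta> * h \<theta>) \<partial>lborel)
      = (\<integral>\<^sup>+\<theta>. (\<integral>\<^sup>+l. ennreal (gamma_dens \<kappa> l \<theta> * h \<theta>) \<partial>H) \<partial>lborel)"
  proof (intro nn_integral_cong)
    fix \<theta> :: real
    show "ennreal (gmix H \<kappa> \<theta> * h \<theta>) = (\<integral>\<^sup>+l. ennreal (gamma_dens \<kappa> l \<theta> * h \<theta>) \<partial>H)"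
    proof (cases "0 < \<theta>")
      case True
      then show ?thesis
        using integrable_gamma_dens[OF H \<kappa>, of \<theta>] \<kappa> h[OF True]
        by (subst nn_integral_eq_integral) (auto simp: gmix_def)
    next
      case False
      then show ?thesis by (simp add: gmix_eq_0 gamma_dens_def)
    qed
  qed
  also have "\<dots> = (\<integral>\<^sup>+l. (\<integral>\<^sup>+\<theta>. ennreal (gamma_dens \<kappa> l \<theta> * h \<theta>) \<partial>lborel) \<partial>H)"
    by (intro Fubini') measurable
  finally show ?thesis .
qed

section \<open>Negative binomial counts and their generating functions\<close>

text \<open>This is the binomial series with exponent -\<kappa> at -w; the signs of the generalized
  binomial coefficients cancel those of the powers.\<close>

lemma negative_binomial_sums:
  fixes \<kappa> w :: real
  assumes "0 < \<kappa>" "0 \<le> w" "w < 1"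
  shows "(\<lambda>x. Gamma (real x + \<kappa>) / (fact x * Gamma \<kappa>) * w ^ x) sums (1 - w) powr - \<kappa>"
proof -
  have "(\<lambda>x. ((- \<kappa>) gchoose x) * (- w) ^ x) sums (1 + - w) powr - \<kappa>"
    using assms by (intro gen_binomial_real) auto
  moreover have "((- \<kappa>) gchoose x) * (- w) ^ x = Gamma (real x + \<kappa>) / (fact x * Gamma \<kappa>) * w ^ x" for x
  proof -
    have "\<kappa> \<notin> \<int>\<^sub>\<le>\<^sub>0" using assms by (auto simp: nonpos_Ints_def)
    then have "pochhammer \<kappa> x = Gamma (real x + \<kappa>) / Gamma \<kappa>"
      by (simp add: pochhammer_Gamma add.commute)
    moreover have "(- 1) ^ x * (- w) ^ x = w ^ x" by (simp flip: power_mult_distrib)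
    ultimately show ?thesis by (simp add: gbinomial_pochhammer field_simps)
  qed
  ultimately show ?thesis by simp
qed

definition nb :: "real \<Rightarrow> nat \<Rightarrow> real \<Rightarrow> real" where
  "nb \<kappa> x l = Gamma (real x + \<kappa>) / (fact x * Gamma \<kappa>) * (1 / (l + 1)) ^ x * (l / (l + 1)) powr \<kappa>"

lemma fmix_nb: "fmix H \<kappa> x = (\<integral>l. nb \<kappa> x l \<partial>H)"
  by (simp add: fmix_def nb_def)

lemma measurable_nb [measurable]: "nb \<kappa> x \<in> borel_measurable borel"
  unfolding nb_def by measurable

lemma nb_nonneg: "0 < \<kappa> \<Longrightarrow> 0 < l \<Longrightarrow> 0 \<le> nb \<kappa> x l"
  by (auto simp: nb_def intro!: mult_nonneg_nonneg divide_nonneg_nonneg Gamma_real_nonneg)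

text \<open>A Poisson count given \<theta> has generating function exp(-(1 - z)\<theta>), so
  averaging over a Gamma variable gives its Laplace transform at 1 - z.\<close>

lemma nb_sums:
  assumes "0 < \<kappa>" "0 < l" "0 \<le> z" "z \<le> 1"
  shows "(\<lambda>x. nb \<kappa> x l * z ^ x) sums (l / (l + (1 - z))) powr \<kappa>"
proof -
  have "(\<lambda>x. Gamma (real x + \<kappa>) / (fact x * Gamma \<kappa>) * (z / (l + 1)) ^ x * (l / (l + 1)) powr \<kappa>)
     sums ((1 - z / (l + 1)) powr - \<kappa> * (l / (l + 1)) powr \<kappa>)"
    using assms by (intro sums_mult2 negative_binomial_sums) auto
  moreover have "(1 - z / (l + 1)) powr - \<kappa> * (l / (l + 1)) powr \<kappa> = (l / (l + (1 - z))) powr \<kappa>"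
  proof -
    have eq: "1 - z / (l + 1) = (l + (1 - z)) / (l + 1)" using assms by (simp add: field_simps)
    show ?thesis unfolding eq using assms by (simp add: powr_divide powr_minus field_simps)
  qed
  ultimately show ?thesis by (simp add: nb_def power_divide mult_ac)
qed

lemma nb_le_1:
  assumes "0 < \<kappa>" "0 < l"
  shows "nb \<kappa> x l \<le> 1"
proof -
  have s: "(\<lambda>x. nb \<kappa> x l) sums 1" using nb_sums[of \<kappa> l 1] assms by simp
  then have "sum (\<lambda>x. nb \<kappa> x l) {x} \<le> (\<Sum>x. nb \<kappa> x l)"
    using assms by (intro sum_le_suminf) (auto simp: sums_iff nb_nonneg)
  then show ?thesis using s by (simp add: sums_iff)
qed

lemma integrable_nb: "H \<in> Ppos \<Longrightarrow> 0 < \<kappa> \<Longrightarrow> integrable H (nb \<kappa> x)"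
  by (rule integrable_Ppos_bounded[where B = 1]) (auto simp: nb_nonneg nb_le_1)

lemma fmix_nonneg: "H \<in> Ppos \<Longrightarrow> 0 < \<kappa> \<Longrightarrow> 0 \<le> fmix H \<kappa> x"
  unfolding fmix_nb using PposD(3)[of H]
  by (intro integral_nonneg_AE) (auto elim!: eventually_mono simp: nb_nonneg)

text \<open>The partial sums under the integral are nonnegative and at most 1, so dominated
  convergence lets the sum and the mixing integral commute. Including z = 1 yields total mass
  1.\<close>

lemma fmix_sums_lap:
  assumes H: "H \<in> Ppos" and \<kappa>: "0 < \<kappa>" and z: "0 \<le> z" "z \<le> 1"
  shows "(\<lambda>x. fmix H \<kappa> x * z ^ x) sums lap \<kappa> H (1 - z)"
proof -
  interpret prob_space H using PposD(1)[OF H] .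
  note [measurable_cong] = PposD(2)[OF H]
  note AE = PposD(3)[OF H]
  have part: "(\<Sum>x<n. fmix H \<kappa> x * z ^ x) = (\<integral>l. (\<Sum>x<n. nb \<kappa> x l * z ^ x) \<partial>H)" for n
    using H \<kappa> by (subst Bochner_Integration.integral_sum) (auto simp: fmix_nb integrable_nb)
  have "(\<lambda>n. \<integral>l. (\<Sum>x<n. nb \<kappa> x l * z ^ x) \<partial>H) \<longlonglongrightarrow> (\<integral>l. (l / (l + (1 - z))) powr \<kappa> \<partial>H)"
  proof (rule integral_dominated_convergence[where w = "\<lambda>_. 1"])
    show "AE l in H. (\<lambda>n. \<Sum>x<n. nb \<kappa> x l * z ^ x) \<longlonglongrightarrow> (l / (l + (1 - z))) powr \<kappa>"
      using AE nb_sums[OF \<kappa> _ z] by (auto simp: sums_def elim!: eventually_mono)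
    show "AE l in H. norm (\<Sum>x<n. nb \<kappa> x l * z ^ x) \<le> 1" for n
      using AE
    proof (rule eventually_mono)
      fix l :: real assume l: "0 < l"
      have "(\<Sum>x<n. nb \<kappa> x l * z ^ x) \<le> (l / (l + (1 - z))) powr \<kappa>"
        using nb_sums[OF \<kappa> l z] \<kappa> l z sum_le_suminf[of "\<lambda>x. nb \<kappa> x l * z ^ x" "{..<n}"]
        by (auto simp: sums_iff nb_nonneg)
      also have "\<dots> \<le> 1 powr \<kappa>" using \<kappa> l z by (intro powr_mono2) auto
      finally show "norm (\<Sum>x<n. nb \<kappa> x l * z ^ x) \<le> 1"
        using \<kappa> l z by (simp add: sum_nonneg nb_nonneg)
    qed
  qed auto
  then show ?thesis by (simp add: sums_def part lap_def)
qed

lemma fmix_sums_1: "H \<in> Ppos \<Longrightarrow> 0 < \<kappa> \<Longrightarrow> fmix H \<kappa> sums 1"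
proof -
  assume H: "H \<in> Ppos" and \<kappa>: "0 < \<kappa>"
  interpret prob_space H using PposD(1)[OF H] .
  have "lap \<kappa> H 0 = (\<integral>l. 1 \<partial>H)"
    unfolding lap_def using PposD[OF H]
    by (intro integral_cong_AE) (auto elim!: eventually_mono simp: measurable_cong_sets[OF PposD(2)[OF H] refl])
  then show ?thesis using fmix_sums_lap[OF H \<kappa>, of 1] by (simp add: prob_space)
qed

lemma Fmix_bounds:
  assumes "H \<in> Ppos" "0 < \<kappa>"
  shows "0 \<le> Fmix H \<kappa> m" "Fmix H \<kappa> m \<le> 1"
  using fmix_nonneg[OF assms] fmix_sums_1[OF assms] sum_le_suminf[of "fmix H \<kappa>" "{..m}"]
  by (auto simp: Fmix_def sum_nonneg sums_iff)

text \<open>By Tonelli the count probabilities depend on the pair of shape and mixing measure only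
  through the density of \<theta>. Hence two representations of one density, even with different
  shapes, give the same counts.\<close>

lemma fmix_eq_gmix:
  assumes H: "H \<in> Ppos" and \<kappa>: "0 < \<kappa>"
  shows "ennreal (fmix H \<kappa> x) = (\<integral>\<^sup>+\<theta>. ennreal (gmix H \<kappa> \<theta> * (exp (- \<theta>) * \<theta> ^ x / fact x)) \<partial>lborel)"
proof -
  have "ennreal (fmix H \<kappa> x) = (\<integral>\<^sup>+l. ennreal (nb \<kappa> x l) \<partial>H)"
    unfolding fmix_nb using PposD(3)[OF H] \<kappa>
    by (intro nn_integral_eq_integral[symmetric] integrable_nb H) (auto elim!: eventually_mono simp: nb_nonneg)
  also have "\<dots> = (\<integral>\<^sup>+l. (\<integral>\<^sup>+\<theta>. ennreal (gamma_dens \<kappa> l \<theta> * (exp (- \<theta>) * \<theta> ^ x / fact x)) \<partial>lborel) \<partial>H)"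
    using PposD(3)[OF H] nn_integral_gamma_dens[OF \<kappa>, of _ 1 x]
    by (intro nn_integral_cong_AE) (auto elim!: eventually_mono simp: nb_def)
  also have "\<dots> = (\<integral>\<^sup>+\<theta>. ennreal (gmix H \<kappa> \<theta> * (exp (- \<theta>) * \<theta> ^ x / fact x)) \<partial>lborel)"
    using H \<kappa> by (intro nn_integral_gmix[symmetric]) auto
  finally show ?thesis .
qed

lemma fmix_cong_gmix:
  assumes "H \<in> Ppos" "0 < \<kappa>" "H' \<in> Ppos" "0 < \<kappa>'"
    and "\<And>\<theta>. 0 < \<theta> \<Longrightarrow> gmix H \<kappa> \<theta> = gmix H' \<kappa>' \<theta>"
  shows "fmix H \<kappa> = fmix H' \<kappa>'"
proof
  fix x
  have "gmix H \<kappa> = gmix H' \<kappa>'"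
    using assms(5) gmix_eq_0 by (metis linorder_not_less ext)
  then have "ennreal (fmix H \<kappa> x) = ennreal (fmix H' \<kappa>' x)"
    using assms by (simp add: fmix_eq_gmix)
  then show "fmix H \<kappa> x = fmix H' \<kappa>' x" using assms by (simp add: fmix_nonneg)
qed

lemma lap_eq_gmix:
  assumes H: "H \<in> Ppos" and \<kappa>: "0 < \<kappa>" and u: "0 \<le> u"
  shows "ennreal (lap \<kappa> H u) = (\<integral>\<^sup>+\<theta>. ennreal (gmix H \<kappa> \<theta> * exp (- u * \<theta>)) \<partial>lborel)"
proof -
  have "\<bar>(l / (l + u)) powr \<kappa>\<bar> \<le> 1" if "0 < l" for l
    using powr_mono2[of \<kappa> "l / (l + u)" 1] that u \<kappa> by simp
  then have "ennreal (lap \<kappa> H u) = (\<integral>\<^sup>+l. ennreal ((l / (l + u)) powr \<kappa>) \<partial>H)"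
    unfolding lap_def using PposD(3)[OF H] \<kappa>
    by (intro nn_integral_eq_integral[symmetric] integrable_Ppos_bounded[OF H, where B = 1]) auto
  also have "\<dots> = (\<integral>\<^sup>+l. (\<integral>\<^sup>+\<theta>. ennreal (gamma_dens \<kappa> l \<theta> * exp (- u * \<theta>)) \<partial>lborel) \<partial>H)"
    using PposD(3)[OF H] nn_integral_gamma_dens[OF \<kappa> _ u, of _ 0] \<kappa> Gamma_real_pos[OF \<kappa>]
    by (intro nn_integral_cong_AE) (auto elim!: eventually_mono)
  also have "\<dots> = (\<integral>\<^sup>+\<theta>. ennreal (gmix H \<kappa> \<theta> * exp (- u * \<theta>)) \<partial>lborel)"
    using H \<kappa> by (intro nn_integral_gmix[symmetric]) auto
  finally show ?thesis .
qed

section \<open>Uniqueness of Laplace transforms\<close>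

lemma times_exp_minus_le:
  fixes x d :: real
  assumes "0 \<le> x" "0 < d"
  shows "x * exp (- d * x) \<le> 1 / d"
proof -
  have "d * x \<le> exp (d * x)" using exp_ge_add_one_self[of "d * x"] by linarith
  then show ?thesis using assms by (simp add: exp_minus field_simps)
qed

text \<open>Differentiation under the integral: on a half-plane Re w > d > 0 the derivative of the
  integrand has norm at most x exp(-dx) \<le> 1/d, which dominates all difference quotients.\<close>

lemma (in real_distribution) holomorphic_laplace:
  assumes nn: "AE x in M. 0 \<le> x"
  shows "(\<lambda>z. (\<integral>x. exp (- z * complex_of_real x) \<partial>M)) holomorphic_on {z. 0 < Re z}"
proof -
  let ?L = "\<lambda>z. (\<integral>x. exp (- z * complex_of_real x) \<partial>M)"
  let ?D = "\<lambda>z. (\<integral>x. - complex_of_real x * exp (- z * complex_of_real x) \<partial>M)"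
  have int: "integrable M (\<lambda>x. exp (- z * complex_of_real x))" if "0 < Re z" for z
    using nn that by (intro integrable_const_bound[where B = 1]) (auto elim!: eventually_mono)
  have "(?L has_field_derivative ?D z) (at z)" if z: "0 < Re z" for z
  proof -
    \<comment> \<open>Half of the real part leaves z inside the open convex half-plane
      \<open>S\<close>, on which the mean value bound is uniform.\<close>
    define d where "d = Re z / 2"
    define S where "S = {w. d < Re w}"
    have d: "0 < d" and zS: "z \<in> S" using z by (auto simp: d_def S_def)
    have S: "open S" "convex S"
      unfolding S_def by (auto simp: open_halfspace_Re_gt convex_halfspace_Re_gt)
    have lip: "norm (exp (- w * complex_of_real x) - exp (- z * complex_of_real x)) \<le> (1 / d) * norm (w - z)"
      if x: "0 \<le> x" and w: "w \<in> S" for w x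
    proof (rule field_differentiable_bound[OF S(2) _ _ w zS])
      fix y assume y: "y \<in> S"
      show "((\<lambda>w. exp (- w * complex_of_real x)) has_field_derivative - x * exp (- y * complex_of_real x)) (at y within S)"
        by (auto intro!: derivative_eq_intros)
      have "norm (- x * exp (- y * complex_of_real x)) = x * exp (- (Re y) * x)"
        using x by (simp add: norm_mult)
      also have "\<dots> \<le> x * exp (- d * x)"
        using x y by (intro mult_left_mono) (auto simp: S_def mult_right_mono)
      also have "\<dots> \<le> 1 / d" using x d by (rule times_exp_minus_le)
      finally show "norm (- x * exp (- y * complex_of_real x)) \<le> 1 / d" .
    qed
    have "((\<lambda>w. (?L w - ?L z) / (w - z)) \<longlongrightarrow> ?D z) (at z within S)"
      unfolding tendsto_at_iff_sequentially comp_def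
    proof (intro allI impI)
      fix X assume X: "\<forall>i. X i \<in> S - {z}" "X \<longlonglongrightarrow> z"
      have "(\<lambda>i. \<integral>x. (exp (- X i * complex_of_real x) - exp (- z * complex_of_real x)) / (X i - z) \<partial>M) \<longlonglongrightarrow> ?D z"
      proof (rule integral_dominated_convergence[where w = "\<lambda>_. 1 / d"])
        show "AE x in M. (\<lambda>i. (exp (- X i * complex_of_real x) - exp (- z * complex_of_real x)) / (X i - z))
           \<longlonglongrightarrow> - complex_of_real x * exp (- z * complex_of_real x)"
        proof (intro always_eventually allI)
          fix x :: real
          have "((\<lambda>w. exp (- w * complex_of_real x)) has_field_derivative - x * exp (- z * complex_of_real x)) (at z within S)"
            by (auto intro!: derivative_eq_intros)
          then show "(\<lambda>i. (exp (- X i * complex_of_real x) - exp (- z * complex_of_real x)) / (X i - z))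
             \<longlonglongrightarrow> - complex_of_real x * exp (- z * complex_of_real x)"
            using X(1)[rule_format] X(2)
            unfolding has_field_derivative_iff tendsto_at_iff_sequentially comp_def by simp
        qed
        show "AE x in M. norm ((exp (- X i * complex_of_real x) - exp (- z * complex_of_real x)) / (X i - z)) \<le> 1 / d" for i
          using nn
        proof (rule eventually_mono)
          fix x :: real assume "0 \<le> x"
          from lip[OF this, of "X i"] X(1) show "norm ((exp (- X i * complex_of_real x) - exp (- z * complex_of_real x)) / (X i - z)) \<le> 1 / d"
            by (auto simp: norm_divide divide_le_eq)
        qed
      qed auto
      moreover have "(\<integral>x. (exp (- X i * complex_of_real x) - exp (- z * complex_of_real x)) / (X i - z) \<partial>M)
          = (?L (X i) - ?L z) / (X i - z)" for i
      proof -
        have "0 < Re (X i)" using X(1)[rule_format, of i] d by (auto simp: S_def)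
        then show ?thesis using int z by (simp add: Bochner_Integration.integral_diff)
      qed
      ultimately show "(\<lambda>i. (?L (X i) - ?L z) / (X i - z)) \<longlonglongrightarrow> ?D z" by (simp only:)
    qed
    then show ?thesis
      using at_within_open[OF zS S(1)] by (simp add: has_field_derivative_iff)
  qed
  then show ?thesis
    using holomorphic_on_open[OF open_halfspace_Re_gt[of 0]] by blast
qed

text \<open>The characteristic function is the boundary value of the Laplace transform at -it,
  approached horizontally from the right.\<close>

lemma (in real_distribution) laplace_tendsto_char:
  assumes nn: "AE x in M. 0 \<le> x"
  shows "(\<lambda>n. \<integral>x. exp (- Complex (1 / real (Suc n)) (- t) * complex_of_real x) \<partial>M) \<longlonglongrightarrow> char M t"
  unfolding char_def
proof (rule integral_dominated_convergence[where w = "\<lambda>_. 1"])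
  show "AE x in M. (\<lambda>n. exp (- Complex (1 / real (Suc n)) (- t) * complex_of_real x)) \<longlonglongrightarrow> iexp (t * x)"
  proof (intro always_eventually allI)
    fix x :: real
    have "(\<lambda>n. exp (- Complex (1 / real (Suc n)) (- t) * complex_of_real x)) \<longlonglongrightarrow> exp (- Complex 0 (- t) * complex_of_real x)"
      by (intro tendsto_intros tendsto_Complex LIMSEQ_Suc lim_1_over_n)
    moreover have "- Complex 0 (- t) * complex_of_real x = \<i> * complex_of_real (t * x)"
      by (simp add: complex_eq_iff)
    ultimately show "(\<lambda>n. exp (- Complex (1 / real (Suc n)) (- t) * complex_of_real x)) \<longlonglongrightarrow> iexp (t * x)"
      by simp
  qed
  show "AE x in M. norm (exp (- Complex (1 / real (Suc n)) (- t) * complex_of_real x)) \<le> 1" for n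
    using nn by (auto elim!: eventually_mono)
qed auto

text \<open>The interval (0, 1] accumulates at 1, an interior point of the right half-plane, so the
  identity theorem extends the equality to that half-plane; boundary limits then equate the
  characteristic functions.\<close>

theorem laplace_uniqueness:
  fixes M N :: "real measure"
  assumes M: "real_distribution M" "AE x in M. 0 \<le> x"
    and N: "real_distribution N" "AE x in N. 0 \<le> x"
    and eq: "\<And>u. 0 < u \<Longrightarrow> u \<le> 1 \<Longrightarrow> (\<integral>x. exp (- u * x) \<partial>M) = (\<integral>x. exp (- u * x) \<partial>N)"
  shows "M = N"
proof (rule Levy_uniqueness[OF M(1) N(1)], rule ext)
  interpret M: real_distribution M by fact
  interpret N: real_distribution N by fact
  fix t :: real
  let ?L = "\<lambda>M z. (\<integral>x. exp (- z * complex_of_real x) \<partial>M)"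
  let ?U = "complex_of_real ` {0<..1}"
  have real: "?L P (complex_of_real u) = complex_of_real (\<integral>x. exp (- u * x) \<partial>P)" for P u
    unfolding integral_complex_of_real[symmetric]
    by (intro Bochner_Integration.integral_cong) (auto simp flip: exp_of_real)
  have conn: "connected {z. 0 < Re z}"
    by (intro convex_connected convex_halfspace_Re_gt)
  have lim: "complex_of_real 1 islimpt ?U"
  proof -
    \<comment> \<open>The shift by 2 keeps the points strictly between 0 and 1, hence different from
      their limit.\<close>
    define f where "f n = complex_of_real (1 - 1 / real (n + 2))" for n
    have "f n \<in> ?U - {complex_of_real 1}" for n
      unfolding f_def by (auto simp: field_simps intro!: imageI simp del: of_real_diff of_real_divide of_real_add)
    moreover have "f \<longlonglongrightarrow> complex_of_real (1 - 0)"
      unfolding f_def by (intro tendsto_of_real tendsto_diff tendsto_const LIMSEQ_ignore_initial_segment[OF lim_1_over_n])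
    ultimately show ?thesis unfolding islimpt_sequential by (intro exI[of _ f]) simp
  qed
  have L: "?L M z = ?L N z" if z: "0 < Re z" for z
  proof -
    have "(\<lambda>z. ?L M z - ?L N z) holomorphic_on {z. 0 < Re z}"
      by (intro holomorphic_on_diff M.holomorphic_laplace N.holomorphic_laplace M N)
    then have "?L M z - ?L N z = 0"
    proof (rule analytic_continuation[where U = ?U and \<xi> = "complex_of_real 1"])
      fix w assume "w \<in> ?U"
      then obtain u where u: "w = complex_of_real u" "0 < u" "u \<le> 1" by auto
      show "?L M w - ?L N w = 0" unfolding u(1) real eq[OF u(2,3)] by simp
    qed (use conn lim z in \<open>auto simp: open_halfspace_Re_gt\<close>)
    then show ?thesis by simp
  qed
  show "char M t = char N t"
  proof (rule LIMSEQ_unique)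
    show "(\<lambda>n. ?L M (Complex (1 / real (Suc n)) (- t))) \<longlonglongrightarrow> char M t"
      by (rule M.laplace_tendsto_char[OF M(2)])
    have "?L M (Complex (1 / real (Suc n)) (- t)) = ?L N (Complex (1 / real (Suc n)) (- t))" for n
      by (rule L) simp
    then show "(\<lambda>n. ?L M (Complex (1 / real (Suc n)) (- t))) \<longlonglongrightarrow> char N t"
      using N.laplace_tendsto_char[OF N(2), of t] by (simp only:)
  qed
qed

section \<open>Compactness of the mixture families\<close>

text \<open>The bound \<open>B\<close> ensures that the real-valued supremum is taken over a bounded
  set.\<close>

lemma dKS_upper:
  assumes "\<And>m. \<bar>F m - G m\<bar> \<le> B"
  shows "\<bar>F m - G m\<bar> \<le> dKS F G"
  unfolding dKS_def by (rule cSUP_upper) (auto intro!: bdd_aboveI2 assms)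

lemma dKS_least: "(\<And>m. \<bar>F m - G m\<bar> \<le> B) \<Longrightarrow> dKS F G \<le> B"
  unfolding dKS_def by (rule cSUP_least) auto

lemma abel_partial_sum:
  fixes a :: "nat \<Rightarrow> real" and z :: real
  shows "(\<Sum>x\<le>n. a x * z ^ x) = (1 - z) * (\<Sum>m<n. (\<Sum>x\<le>m. a x) * z ^ m) + (\<Sum>x\<le>n. a x) * z ^ n"
  by (induction n) (simp_all add: algebra_simps)

text \<open>After Abel summation, the truncated difference of generating functions is a weighted
  average of differences of distribution functions: the weights (1 - z)z^m for m < n and the
  boundary weight z^n add up to 1.\<close>

lemma lap_diff_le_dKS:
  assumes H: "H \<in> Ppos" "0 < \<kappa>" and H': "H' \<in> Ppos" "0 < \<kappa>'" and u: "0 < u" "u \<le> 1"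
  shows "\<bar>lap \<kappa> H u - lap \<kappa>' H' u\<bar> \<le> dKS (Fmix H \<kappa>) (Fmix H' \<kappa>')"
proof -
  define z where "z = 1 - u"
  have z: "0 \<le> z" "z < 1" "u = 1 - z" using u by (auto simp: z_def)
  define a where "a x = fmix H \<kappa> x - fmix H' \<kappa>' x" for x
  let ?K = "dKS (Fmix H \<kappa>) (Fmix H' \<kappa>')"
  have A: "\<bar>\<Sum>x\<le>m. a x\<bar> \<le> ?K" for m
  proof -
    have "(\<Sum>x\<le>m. a x) = Fmix H \<kappa> m - Fmix H' \<kappa>' m"
      by (simp add: a_def Fmix_def sum_subtractf)
    moreover have "\<bar>Fmix H \<kappa> m - Fmix H' \<kappa>' m\<bar> \<le> 1" for m
      using Fmix_bounds[OF H, of m] Fmix_bounds[OF H', of m] by linarith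
    ultimately show ?thesis using dKS_upper[of "Fmix H \<kappa>" "Fmix H' \<kappa>'" 1 m] by simp
  qed
  have "(\<lambda>x. a x * z ^ x) sums (lap \<kappa> H u - lap \<kappa>' H' u)"
    using sums_diff[OF fmix_sums_lap[OF H, of z] fmix_sums_lap[OF H', of z]] z
    by (simp add: a_def left_diff_distrib)
  then have lim: "(\<lambda>n. \<bar>\<Sum>x\<le>n. a x * z ^ x\<bar>) \<longlonglongrightarrow> \<bar>lap \<kappa> H u - lap \<kappa>' H' u\<bar>"
    by (intro tendsto_rabs) (simp add: sums_def_le)
  have "\<bar>\<Sum>x\<le>n. a x * z ^ x\<bar> \<le> ?K" for n
  proof -
    have "\<bar>\<Sum>x\<le>n. a x * z ^ x\<bar> \<le> (1 - z) * (\<Sum>m<n. \<bar>\<Sum>x\<le>m. a x\<bar> * z ^ m) + \<bar>\<Sum>x\<le>n. a x\<bar> * z ^ n"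
      unfolding abel_partial_sum using z
      by (auto intro!: abs_triangle_ineq[THEN order_trans] add_mono mult_left_mono sum_abs[THEN order_trans]
          sum_mono simp: abs_mult)
    also have "\<dots> \<le> (1 - z) * (\<Sum>m<n. ?K * z ^ m) + ?K * z ^ n"
      using z A by (intro add_mono mult_left_mono mult_right_mono sum_mono) auto
    also have "\<dots> = ?K * ((1 - z) * (\<Sum>m<n. z ^ m) + z ^ n)"
      by (simp add: sum_distrib_left algebra_simps)
    also have "(1 - z) * (\<Sum>m<n. z ^ m) + z ^ n = 1"
      using one_diff_power_eq[of z n] by simp
    finally show ?thesis by simp
  qed
  then show ?thesis by (intro LIMSEQ_le_const2[OF lim]) auto
qed

lemma ratio_powr_le_1:
  fixes l u \<kappa> :: real
  assumes "0 < l" "0 < \<kappa>" "0 \<le> u"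
  shows "(l / (l + u)) powr \<kappa> \<le> 1"
  using powr_mono2[of \<kappa> "l / (l + u)" 1] assms by simp

lemma lap_integrable:
  assumes "H \<in> Ppos" "0 < \<kappa>" "0 \<le> u"
  shows "integrable H (\<lambda>l. (l / (l + u)) powr \<kappa>)"
proof (rule integrable_Ppos_bounded[OF assms(1), where B = 1])
  show "\<bar>(l / (l + u)) powr \<kappa>\<bar> \<le> 1" if "0 < l" for l
    using ratio_powr_le_1[OF that assms(2,3)] by simp
qed auto

lemma lap_strict_antimono:
  assumes H: "H \<in> Ppos" and \<kappa>: "0 < \<kappa>" and u: "0 \<le> u" "u < v"
  shows "lap \<kappa> H v < lap \<kappa> H u"
proof -
  interpret prob_space H using PposD(1)[OF H] .
  have "(l / (l + v)) powr \<kappa> < (l / (l + u)) powr \<kappa>" if "0 < l" for l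
    using that u \<kappa> by (intro powr_less_mono2) (auto simp: frac_less2)
  then show ?thesis
    unfolding lap_def using PposD(3)[OF H] u H \<kappa>
    by (intro integral_less_AE_space lap_integrable) (auto elim!: eventually_mono simp: emeasure_space_1)
qed

text \<open>This keeps the shapes of an approximating sequence away from \<open>0\<close>: the limiting transform
  would be constant, contradicting \<open>lap_strict_antimono\<close>.\<close>

lemma lap_diff_le_shape:
  assumes H: "H \<in> Ppos" and \<kappa>: "0 < \<kappa>"
  shows "lap \<kappa> H (1/2) - lap \<kappa> H 1 \<le> 1 - (1/2) powr \<kappa>"
proof -
  interpret prob_space H using PposD(1)[OF H] .
  have le: "(l / (l + 1/2)) powr \<kappa> - (l / (l + 1)) powr \<kappa> \<le> 1 - (1/2) powr \<kappa>" if l: "0 < l" for l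
  proof -
    \<comment> \<open>\<open>q\<close> is the quotient of the two ratios being compared; it lies in
      [1/2, 1] because 2(l + 1/2) \<ge> l + 1.\<close>
    define q where "q = (l + 1/2) / (l + 1)"
    have q: "1/2 \<le> q" "q \<le> 1" using l by (auto simp: q_def field_simps)
    have "l / (l + 1) = (l / (l + 1/2)) * q" using l by (simp add: q_def)
    then have "(l / (l + 1/2)) powr \<kappa> - (l / (l + 1)) powr \<kappa> = (l / (l + 1/2)) powr \<kappa> * (1 - q powr \<kappa>)"
      using l q by (simp only: powr_mult) (simp add: algebra_simps)
    also have "\<dots> \<le> 1 * (1 - (1/2) powr \<kappa>)"
      using powr_mono2[of \<kappa> "l / (l + 1/2)" 1] powr_mono2[of \<kappa> "1/2" q] powr_mono2[of \<kappa> q 1] q l \<kappa>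
      by (intro mult_mono) auto
    finally show ?thesis by simp
  qed
  have "lap \<kappa> H (1/2) - lap \<kappa> H 1 = (\<integral>l. (l / (l + 1/2)) powr \<kappa> - (l / (l + 1)) powr \<kappa> \<partial>H)"
    unfolding lap_def by (intro Bochner_Integration.integral_diff[symmetric] lap_integrable H \<kappa>) auto
  also have "\<dots> \<le> (\<integral>l. 1 - (1/2) powr \<kappa> \<partial>H)"
    using PposD(3)[OF H] le
    by (intro integral_mono_AE Bochner_Integration.integrable_diff lap_integrable H \<kappa>)
      (auto elim!: eventually_mono)
  finally show ?thesis by (simp add: prob_space)
qed

text \<open>Since the mixing measure lives on positive rates, no mass is lost as u tends to 0. A
  limit mixture with the same transform inherits this.\<close>

lemma lap_tendsto_1:
  assumes H: "H \<in> Ppos" and \<kappa>: "0 < \<kappa>"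
  shows "(\<lambda>n. lap \<kappa> H (1 / real (Suc n))) \<longlonglongrightarrow> 1"
proof -
  interpret prob_space H using PposD(1)[OF H] .
  note [measurable_cong] = PposD(2)[OF H]
  have "(\<lambda>n. \<integral>l. (l / (l + 1 / real (Suc n))) powr \<kappa> \<partial>H) \<longlonglongrightarrow> (\<integral>l. 1 \<partial>H)"
  proof (rule integral_dominated_convergence[where w = "\<lambda>_. 1"])
    show "AE l in H. (\<lambda>n. (l / (l + 1 / real (Suc n))) powr \<kappa>) \<longlonglongrightarrow> 1"
      using PposD(3)[OF H]
    proof (rule eventually_mono)
      fix l :: real assume "0 < l"
      then have "(\<lambda>n. (l / (l + 1 / real (Suc n))) powr \<kappa>) \<longlonglongrightarrow> (l / (l + 0)) powr \<kappa>"
        by (intro tendsto_intros LIMSEQ_Suc lim_1_over_n) auto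
      then show "(\<lambda>n. (l / (l + 1 / real (Suc n))) powr \<kappa>) \<longlonglongrightarrow> 1" using \<open>0 < l\<close> by simp
    qed
    show "AE l in H. norm ((l / (l + 1 / real (Suc n))) powr \<kappa>) \<le> 1" for n
      using PposD(3)[OF H]
    proof (rule eventually_mono)
      fix l :: real assume "0 < l"
      then show "norm ((l / (l + 1 / real (Suc n))) powr \<kappa>) \<le> 1"
        using ratio_powr_le_1[of l \<kappa> "1 / real (Suc n)"] \<kappa> by simp
    qed
  qed auto
  then show ?thesis by (simp add: lap_def prob_space)
qed

section \<open>Subsequential limits of mixtures\<close>

text \<open>Transported to [0, 1] the mixing measures are tight, so a subsequence converges weakly.
  Skorohod's representation turns this into pointwise convergence, so that dominated convergence can
  handle an exponent that moves with the sequence.\<close>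

lemma lap_subsequential_limit:
  fixes H :: "nat \<Rightarrow> real measure"
  assumes H: "\<And>j. H j \<in> Ppos" and k: "\<And>j. 0 < k j" "k \<longlonglongrightarrow> \<kappa>" "0 < \<kappa>"
    and lim: "\<And>u. 0 < u \<Longrightarrow> u \<le> 1 \<Longrightarrow> (\<lambda>j. lap (k j) (H j) u) \<longlonglongrightarrow> L u"
  obtains \<nu> where "real_distribution \<nu>" "AE y in \<nu>. 0 \<le> y \<and> y \<le> 1"
    "\<And>u. 0 < u \<Longrightarrow> u \<le> 1 \<Longrightarrow> (\<integral>y. (y / (y + u * (1 - y))) powr \<kappa> \<partial>\<nu>) = L u"
proof -
  define \<mu> where "\<mu> j = distr (H j) borel (\<lambda>l. l / (1 + l))" for j
  have [measurable]: "(\<lambda>l::real. l / (1 + l)) \<in> H j \<rightarrow>\<^sub>M borel" for j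
    unfolding measurable_cong_sets[OF PposD(2)[OF H[of j]] refl] by measurable
  have \<mu>: "real_distribution (\<mu> j)" for j
  proof -
    interpret prob_space "H j" using PposD(1)[OF H] .
    show ?thesis unfolding \<mu>_def by (intro real_distribution_distr) measurable
  qed
  have AE01: "AE y in \<mu> j. 0 \<le> y \<and> y \<le> 1" for j
    unfolding \<mu>_def using PposD(3)[OF H[of j]]
    by (subst AE_distr_iff) (auto elim!: eventually_mono)
  have "tight \<mu>"
    unfolding tight_def
  proof (intro conjI allI impI \<mu>)
    fix \<epsilon> :: real assume "0 < \<epsilon>"
    \<comment> \<open>Tightness is stated with intervals open on the left; starting at -1 keeps the
      endpoint 0.\<close>
    have "measure (\<mu> j) {-1<..1} = 1" for j
    proof -
      interpret real_distribution "\<mu> j" by (rule \<mu>)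
      show ?thesis using AE01[of j] by (subst prob_eq_1) (auto elim!: eventually_mono)
    qed
    then show "\<exists>a b. a < b \<and> (\<forall>n. 1 - \<epsilon> < measure (\<mu> n) {a<..b})"
      using \<open>0 < \<epsilon>\<close> by (intro exI[of _ "-1"] exI[of _ 1]) simp
  qed
  from tight_imp_convergent_subsubsequence[OF this strict_mono_id]
  obtain r \<nu> where r: "strict_mono r" and \<nu>: "real_distribution \<nu>" and wc: "weak_conv_m (\<mu> \<circ> r) \<nu>"
    by auto
  obtain \<Omega> :: "real measure" and Z Y where \<Omega>: "prob_space \<Omega>"
    and Z[measurable]: "\<And>n. Z n \<in> borel_measurable \<Omega>" and dZ: "\<And>n. distr \<Omega> borel (Z n) = \<mu> (r n)"
    and Y: "Y \<in> measurable \<Omega> lborel" and dY: "distr \<Omega> borel Y = \<nu>"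
    and ZY: "\<And>x. x \<in> space \<Omega> \<Longrightarrow> (\<lambda>n. Z n x) \<longlonglongrightarrow> Y x"
    using Skorohod[of "\<lambda>n. \<mu> (r n)" \<nu>, OF \<mu> \<nu> wc[unfolded comp_def]] by blast
  have Y'[measurable]: "Y \<in> borel_measurable \<Omega>" using Y by simp
  interpret \<Omega>: prob_space \<Omega> by fact
  have AEZ: "AE x in \<Omega>. \<forall>n. 0 \<le> Z n x \<and> Z n x \<le> 1"
    unfolding AE_all_countable
  proof
    fix n show "AE x in \<Omega>. 0 \<le> Z n x \<and> Z n x \<le> 1"
      using AE01[of "r n"] unfolding dZ[symmetric] by (subst (asm) AE_distr_iff) auto
  qed
  have AEY: "AE x in \<Omega>. 0 \<le> Y x \<and> Y x \<le> 1"
    using AEZ AE_space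
  proof eventually_elim
    case (elim x)
    then show ?case
      using ZY[of x] LIMSEQ_le_const[of "\<lambda>n. Z n x" "Y x" 0] LIMSEQ_le_const2[of "\<lambda>n. Z n x" "Y x" 1] by auto
  qed
  show thesis
  proof (rule that[of \<nu>])
    show "AE y in \<nu>. 0 \<le> y \<and> y \<le> 1"
      unfolding dY[symmetric] using AEY by (subst AE_distr_iff) auto
    fix u :: real assume u: "0 < u" "u \<le> 1"
    \<comment> \<open>The denominator is the convex combination of 1 and u with weights y and 1 - y,
      hence positive even at y = 0. Both endpoints of the compactification are therefore
      harmless.\<close>
    have den: "0 < y + u * (1 - y)" "y \<le> y + u * (1 - y)" if "0 \<le> y" "y \<le> 1" for y
      using that u mult_right_mono[of u 1 y] by (auto simp: right_diff_distrib intro: add_nonneg_pos)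
    define q where "q y = y / (y + u * (1 - y))" for y
    have [measurable]: "q \<in> borel_measurable borel" unfolding q_def by measurable
    have q: "0 \<le> q y" "q y \<le> 1" if "0 \<le> y" "y \<le> 1" for y
      using den[OF that] that by (auto simp: q_def)
    have "(\<lambda>n. \<integral>x. q (Z n x) powr k (r n) \<partial>\<Omega>) \<longlonglongrightarrow> (\<integral>x. q (Y x) powr \<kappa> \<partial>\<Omega>)"
    proof (rule integral_dominated_convergence[where w = "\<lambda>_. 1"])
      show "AE x in \<Omega>. (\<lambda>n. q (Z n x) powr k (r n)) \<longlonglongrightarrow> q (Y x) powr \<kappa>"
        using AEZ AEY AE_space
      proof eventually_elim
        case (elim x)
        have "(\<lambda>n. q (Z n x)) \<longlonglongrightarrow> q (Y x)"
          unfolding q_def using den[of "Y x"] elim ZY by (intro tendsto_intros) auto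
        moreover have "(\<lambda>n. k (r n)) \<longlonglongrightarrow> \<kappa>"
          using LIMSEQ_subseq_LIMSEQ[OF k(2) r] by (simp add: comp_def)
        ultimately show ?case
          \<comment> \<open>The base may tend to 0; the power still converges because the limiting
            exponent is positive and the bases are nonnegative.\<close>
          using elim k(3) by (intro tendsto_powr') (auto intro!: always_eventually q)
      qed
      show "AE x in \<Omega>. norm (q (Z n x) powr k (r n)) \<le> 1" for n
        using AEZ
      proof eventually_elim
        case (elim x)
        then show ?case using powr_mono2[of "k (r n)" "q (Z n x)" 1] q[of "Z n x"] k(1)[of "r n"] by auto
      qed
    qed auto
    moreover have "(\<integral>x. q (Z n x) powr k (r n) \<partial>\<Omega>) = lap (k (r n)) (H (r n)) u" for n
    proof -
      have "(\<integral>x. q (Z n x) powr k (r n) \<partial>\<Omega>) = (\<integral>y. q y powr k (r n) \<partial>\<mu> (r n))"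
        unfolding dZ[symmetric] by (subst integral_distr) auto
      also have "\<dots> = (\<integral>l. q (l / (1 + l)) powr k (r n) \<partial>H (r n))"
        unfolding \<mu>_def by (subst integral_distr) auto
      also have "\<dots> = lap (k (r n)) (H (r n)) u"
        unfolding lap_def
      proof (rule integral_cong_AE)
        show "AE l in H (r n). q (l / (1 + l)) powr k (r n) = (l / (l + u)) powr k (r n)"
          using PposD(3)[OF H[of "r n"]]
        proof (rule eventually_mono)
          fix l :: real assume l: "0 < l"
          have "1 - l / (1 + l) = 1 / (1 + l)" using l by (simp add: field_simps)
          then have "l / (1 + l) + u * (1 - l / (1 + l)) = (l + u) / (1 + l)"
            by (simp add: add_divide_distrib)
          then have "q (l / (1 + l)) = l / (l + u)" using l by (simp add: q_def)
          then show "q (l / (1 + l)) powr k (r n) = (l / (l + u)) powr k (r n)" by simp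
        qed
      qed (unfold measurable_cong_sets[OF PposD(2)[OF H] refl], measurable)
      finally show ?thesis .
    qed
    moreover have "(\<lambda>n. lap (k (r n)) (H (r n)) u) \<longlonglongrightarrow> L u"
      using LIMSEQ_subseq_LIMSEQ[OF lim[OF u] r] by (simp add: comp_def)
    ultimately have "(\<integral>x. q (Y x) powr \<kappa> \<partial>\<Omega>) = L u"
      by (auto intro: LIMSEQ_unique)
    then show "(\<integral>y. (y / (y + u * (1 - y))) powr \<kappa> \<partial>\<nu>) = L u"
      unfolding dY[symmetric] q_def[symmetric] by (subst integral_distr) auto
  qed (rule \<nu>)
qed

text \<open>As u tends to 0 the integrand tends to the indicator of y > 0, so the limit 1 is the
  mass of the positive points.\<close>

lemma limit_no_atom_at_0:
  fixes \<nu> :: "real measure"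
  assumes \<nu>: "real_distribution \<nu>" and AE: "AE y in \<nu>. 0 \<le> y \<and> y \<le> 1" and \<kappa>: "0 < \<kappa>"
    and lim: "(\<lambda>n. \<integral>y. (y / (y + 1 / real (Suc n) * (1 - y))) powr \<kappa> \<partial>\<nu>) \<longlonglongrightarrow> 1"
  shows "AE y in \<nu>. 0 < y"
proof -
  interpret real_distribution \<nu> by fact
  have "(\<lambda>n. \<integral>y. (y / (y + 1 / real (Suc n) * (1 - y))) powr \<kappa> \<partial>\<nu>) \<longlonglongrightarrow> (\<integral>y. indicator {0<..} y \<partial>\<nu>)"
  proof (rule integral_dominated_convergence[where w = "\<lambda>_. 1"])
    show "AE y in \<nu>. (\<lambda>n. (y / (y + 1 / real (Suc n) * (1 - y))) powr \<kappa>) \<longlonglongrightarrow> indicator {0<..} y"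
      using AE
    proof (rule eventually_mono)
      fix y :: real assume y: "0 \<le> y \<and> y \<le> 1"
      show "(\<lambda>n. (y / (y + 1 / real (Suc n) * (1 - y))) powr \<kappa>) \<longlonglongrightarrow> indicator {0<..} y"
      proof (cases "y = 0")
        case False
        then have "(\<lambda>n. (y / (y + 1 / real (Suc n) * (1 - y))) powr \<kappa>) \<longlonglongrightarrow> (y / (y + 0 * (1 - y))) powr \<kappa>"
          using y by (intro tendsto_intros LIMSEQ_Suc lim_1_over_n) auto
        then show ?thesis using False y by simp
      qed simp
    qed
    show "AE y in \<nu>. norm ((y / (y + 1 / real (Suc n) * (1 - y))) powr \<kappa>) \<le> 1" for n
      using AE
    proof (rule eventually_mono)
      fix y :: real assume y: "0 \<le> y \<and> y \<le> 1"
      have "0 \<le> 1 / real (Suc n) * (1 - y)" using y by (intro mult_nonneg_nonneg) auto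
      then have "y / (y + 1 / real (Suc n) * (1 - y)) \<le> 1" "0 \<le> y / (y + 1 / real (Suc n) * (1 - y))"
        using y by (auto simp: divide_le_eq_1 intro!: divide_nonneg_nonneg add_nonneg_nonneg)
      then show "norm ((y / (y + 1 / real (Suc n) * (1 - y))) powr \<kappa>) \<le> 1"
        using powr_mono2[of \<kappa> _ 1] \<kappa> by auto
    qed
  qed auto
  then have "prob {0<..} = 1" using LIMSEQ_unique[OF lim] by simp
  then show ?thesis by (subst (asm) prob_eq_1) auto
qed

section \<open>Identification of the limit as an admissible density\<close>

text \<open>Continuity will upgrade almost everywhere equality of densities to equality at every
  positive \<theta>. The rate-uniform bound on the Gamma density supplies the dominating
  constant.\<close>

lemma continuous_on_gmix:
  assumes H: "H \<in> Ppos" and \<kappa>: "0 < \<kappa>"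
  shows "continuous_on {0<..} (gmix H \<kappa>)"
  unfolding continuous_on_sequentially
proof (intro allI ballI impI, elim conjE)
  fix X :: "nat \<Rightarrow> real" and \<theta> :: real
  assume \<theta>: "\<theta> \<in> {0<..}" and X: "\<forall>n. X n \<in> {0<..}" and lim: "X \<longlonglongrightarrow> \<theta>"
  note [measurable_cong] = PposD(2)[OF H]
  define C where "C = exp (\<kappa> * ln \<kappa> - \<kappa>) / Gamma \<kappa>"
  have C: "0 < C" using \<kappa> by (simp add: C_def Gamma_real_pos)
  obtain b where b: "0 < b" "\<And>n. b \<le> X n"
  proof -
    obtain N where N: "\<And>n. N \<le> n \<Longrightarrow> \<theta> / 2 < X n"
      using order_tendstoD(1)[OF lim, of "\<theta> / 2"] \<theta> by (auto simp: eventually_sequentially)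
    \<comment> \<open>Convergence bounds the tail below by \<theta>/2; the minimum also covers the
      finitely many earlier terms.\<close>
    define b where "b = Min (insert (\<theta> / 2) (X ` {..<N}))"
    have "0 < b" using \<theta> X by (auto simp: b_def)
    moreover have "b \<le> X n" for n
    proof (cases "n < N")
      case True
      then show ?thesis by (auto simp: b_def intro!: Min_le)
    next
      case False
      have "b \<le> \<theta> / 2" unfolding b_def by (rule Min_le) auto
      then show ?thesis using N[of n] False by simp
    qed
    ultimately show thesis by (rule that)
  qed
  have "(\<lambda>n. \<integral>l. gamma_dens \<kappa> l (X n) \<partial>H) \<longlonglongrightarrow> (\<integral>l. gamma_dens \<kappa> l \<theta> \<partial>H)"
  proof (rule integral_dominated_convergence[where w = "\<lambda>_. C / b"])
    show "AE l in H. (\<lambda>n. gamma_dens \<kappa> l (X n)) \<longlonglongrightarrow> gamma_dens \<kappa> l \<theta>"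
    proof (intro always_eventually allI)
      fix l :: real
      have "(\<lambda>n. l powr \<kappa> / Gamma \<kappa> * X n powr (\<kappa> - 1) * exp (- l * X n))
          \<longlonglongrightarrow> l powr \<kappa> / Gamma \<kappa> * \<theta> powr (\<kappa> - 1) * exp (- l * \<theta>)"
        using \<theta> lim by (intro tendsto_intros) auto
      then show "(\<lambda>n. gamma_dens \<kappa> l (X n)) \<longlonglongrightarrow> gamma_dens \<kappa> l \<theta>"
        using X \<theta> by (simp add: gamma_dens_def)
    qed
    show "AE l in H. norm (gamma_dens \<kappa> l (X n)) \<le> C / b" for n
      using PposD(3)[OF H]
    proof (rule eventually_mono)
      fix l :: real assume "0 < l"
      then have "gamma_dens \<kappa> l (X n) \<le> C / X n"
        using gamma_dens_le[OF \<kappa>, of l "X n"] X by (simp add: C_def)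
      also have "\<dots> \<le> C / b" using b(2)[of n] b(1) C by (intro divide_left_mono mult_pos_pos) auto
      finally show "norm (gamma_dens \<kappa> l (X n)) \<le> C / b" using \<kappa> by simp
    qed
    interpret prob_space H using PposD(1)[OF H] .
    show "integrable H (\<lambda>_. C / b)" by simp
  qed auto
  then show "(gmix H \<kappa> \<circ> X) \<longlonglongrightarrow> gmix H \<kappa> \<theta>" by (simp add: gmix_def comp_def)
qed

abbreviation mixdist :: "real measure \<Rightarrow> real \<Rightarrow> real measure" where
  "mixdist H \<kappa> \<equiv> density lborel (\<lambda>\<theta>. ennreal (gmix H \<kappa> \<theta>))"

text \<open>The Tonelli identity for the transform gives the Laplace formula, and its value at u = 0
  gives total mass 1.\<close>

lemma
  assumes H: "H \<in> Ppos" and \<kappa>: "0 < \<kappa>"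
  shows real_distribution_mixdist: "real_distribution (mixdist H \<kappa>)"
    and AE_mixdist: "AE \<theta> in mixdist H \<kappa>. 0 < \<theta>"
    and laplace_mixdist: "0 \<le> u \<Longrightarrow> (\<integral>\<theta>. exp (- u * \<theta>) \<partial>mixdist H \<kappa>) = lap \<kappa> H u"
proof -
  note [measurable] = measurable_gmix[OF H]
  have eq: "(\<integral>\<^sup>+\<theta>. ennreal (exp (- u * \<theta>)) \<partial>mixdist H \<kappa>) = ennreal (lap \<kappa> H u)" if "0 \<le> u" for u
    using H \<kappa> lap_eq_gmix[OF H \<kappa> that]
    by (subst nn_integral_density) (auto simp: gmix_nonneg ennreal_mult)
  have "lap \<kappa> H 0 = 1" using fmix_sums_lap[OF H \<kappa>, of 1] fmix_sums_1[OF H \<kappa>] by (simp add: sums_iff)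
  then have "emeasure (mixdist H \<kappa>) (space (mixdist H \<kappa>)) = 1"
    using eq[of 0] by simp
  then show "real_distribution (mixdist H \<kappa>)"
    by (auto simp: real_distribution_def real_distribution_axioms_def intro!: prob_spaceI)
  show "AE \<theta> in mixdist H \<kappa>. 0 < \<theta>"
    using gmix_eq_0[of _ H \<kappa>] by (subst AE_density) (auto intro!: always_eventually, metis not_le order_less_irrefl)
  show "(\<integral>\<theta>. exp (- u * \<theta>) \<partial>mixdist H \<kappa>) = lap \<kappa> H u" if "0 \<le> u"
  proof -
    have "0 \<le> lap \<kappa> H u" unfolding lap_def by (intro integral_nonneg_AE) auto
    then show ?thesis using eq[OF that] by (subst integral_eq_nn_integral) auto
  qed
qed

lemma inG_if_lap_eq:
  assumes H: "H \<in> Ppos" "0 < \<kappa>" and H': "H' \<in> Ppos" "0 < \<kappa>'"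
    and eq: "\<And>u. 0 < u \<Longrightarrow> u \<le> 1 \<Longrightarrow> lap \<kappa> H u = lap \<kappa>' H' u"
  shows "inG \<kappa> (gmix H' \<kappa>')"
proof -
  note [measurable] = measurable_gmix[OF H(1)] measurable_gmix[OF H'(1)]
  have "mixdist H \<kappa> = mixdist H' \<kappa>'"
  proof (rule laplace_uniqueness)
    show "AE \<theta> in mixdist H \<kappa>. 0 \<le> \<theta>" "AE \<theta> in mixdist H' \<kappa>'. 0 \<le> \<theta>"
      using AE_mixdist[OF H] AE_mixdist[OF H'] by (auto elim!: eventually_mono)
    show "(\<integral>\<theta>. exp (- u * \<theta>) \<partial>mixdist H \<kappa>) = (\<integral>\<theta>. exp (- u * \<theta>) \<partial>mixdist H' \<kappa>')"
      if "0 < u" "u \<le> 1" for u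
      using eq[OF that] laplace_mixdist[OF H, of u] laplace_mixdist[OF H', of u] that by simp
  qed (intro real_distribution_mixdist H H')+
  then have "AE \<theta> in lborel. ennreal (gmix H \<kappa> \<theta>) = ennreal (gmix H' \<kappa>' \<theta>)"
    by (intro sigma_finite_measure.density_unique[OF sigma_finite_lborel]) auto
  then have AE: "AE \<theta> in lborel. gmix H \<kappa> \<theta> = gmix H' \<kappa>' \<theta>"
    using H(2) H'(2) by (auto simp: gmix_nonneg)
  \<comment> \<open>\<open>D\<close> is the set of disagreement, open by continuity. Its complement
    is closed and of full Lebesgue measure, hence everything.\<close>
  define D where "D = {\<theta> \<in> {0<..}. gmix H \<kappa> \<theta> - gmix H' \<kappa>' \<theta> \<in> - {0}}"
  have "open D"
    unfolding D_def
    by (intro continuous_open_preimage[unfolded vimage_def Int_def mem_Collect_eq, simplified]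
        continuous_on_diff continuous_on_gmix H H') auto
  then have "closed (- D)" by (rule closed_Compl)
  moreover have "AE \<theta> in lebesgue. \<theta> \<in> - D"
    using AE_completion[OF AE] by (rule eventually_mono) (simp add: D_def)
  ultimately have "\<theta> \<in> - D" for \<theta> by (rule mem_closed_if_AE_lebesgue)
  then have "\<forall>\<theta>>0. gmix H' \<kappa>' \<theta> = gmix H \<kappa> \<theta>" by (auto simp: D_def)
  then show ?thesis using H(1) by (auto simp: inG_def)
qed

text \<open>The point \<open>y = 1\<close> of the compactification encodes an infinite rate, i.e. \<open>\<theta> = 0\<close>.\<close>

lemma limit_no_atom_at_1:
  fixes \<nu> :: "real measure"
  assumes \<nu>: "real_distribution \<nu>" and AE: "AE y in \<nu>. 0 < y \<and> y \<le> 1" and \<kappa>: "0 < \<kappa>"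
    and H': "H' \<in> Ppos" "0 < \<kappa>'"
    and eq: "\<And>u. 0 < u \<Longrightarrow> u \<le> 1 \<Longrightarrow> (\<integral>y. (y / (y + u * (1 - y))) powr \<kappa> \<partial>\<nu>) = lap \<kappa>' H' u"
  shows "AE y in \<nu>. y < 1"
proof -
  interpret \<nu>: real_distribution \<nu> by fact
  define G where "G = density lborel (\<lambda>g. ennreal (gamma_dens \<kappa> 1 g))"
  have [measurable_cong]: "sets G = sets borel" by (simp add: G_def)
  have nnG: "(\<integral>\<^sup>+g. ennreal (exp (- v * g)) \<partial>G) = ennreal ((1 / (1 + v)) powr \<kappa>)" if "0 \<le> v" for v
    using nn_integral_gamma_dens[OF \<kappa> _ that, of 1 0] \<kappa> Gamma_real_pos[OF \<kappa>]
    unfolding G_def by (subst nn_integral_density) (auto simp: ennreal_mult)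
  have "emeasure G (space G) = 1" using nnG[of 0] by simp
  then interpret G: prob_space G by (rule prob_spaceI)
  have AEG: "AE g in G. 0 < g"
    unfolding G_def by (subst AE_density) (auto intro!: always_eventually simp: gamma_dens_def)
  interpret P: pair_prob_space \<nu> G ..
  \<comment> \<open>For the rate l = y / (1 - y), a Gamma variable of rate l is g / l with g of rate
    1. So \<open>N\<close> is the law of \<theta> under the limit mixture, and y = 1 yields \<theta>
    = 0.\<close>
  define N where "N = distr (\<nu> \<Otimes>\<^sub>M G) borel (\<lambda>(y, g). g * ((1 - y) / y))"
  have N: "real_distribution N" unfolding N_def by (intro P.real_distribution_distr) measurable
  interpret N: real_distribution N by fact
  have AEN: "AE \<theta> in N. 0 \<le> \<theta>"
    unfolding N_def
  proof (subst AE_distr_iff)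
    have "AE x in \<nu> \<Otimes>\<^sub>M G. 0 \<le> snd x * ((1 - fst x) / fst x)"
    proof (rule P.AE_pair_measure)
      show "AE y in \<nu>. AE g in G. 0 \<le> snd (y, g) * ((1 - fst (y, g)) / fst (y, g))"
        using AE
      proof eventually_elim
        case (elim y)
        show ?case using AEG by eventually_elim (use elim in \<open>auto intro!: mult_nonneg_nonneg\<close>)
      qed
    qed measurable
    then show "AE x in \<nu> \<Otimes>\<^sub>M G. 0 \<le> (case x of (y, g) \<Rightarrow> g * ((1 - y) / y))"
      by (simp add: case_prod_beta)
  qed auto
  have "N = mixdist H' \<kappa>'"
  proof (rule laplace_uniqueness)
    show "AE x in mixdist H' \<kappa>'. 0 \<le> x"
      using AE_mixdist[OF H'] by (auto elim: eventually_mono)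
    fix u :: real assume u: "0 < u" "u \<le> 1"
    have "(\<integral>\<^sup>+\<theta>. ennreal (exp (- u * \<theta>)) \<partial>N) = (\<integral>\<^sup>+y. (\<integral>\<^sup>+g. ennreal (exp (- u * (g * ((1 - y) / y)))) \<partial>G) \<partial>\<nu>)"
      unfolding N_def by (subst nn_integral_distr) (auto simp: case_prod_beta G.nn_integral_fst[symmetric])
    also have "\<dots> = (\<integral>\<^sup>+y. ennreal ((y / (y + u * (1 - y))) powr \<kappa>) \<partial>\<nu>)"
    proof (rule nn_integral_cong_AE)
      show "AE y in \<nu>. (\<integral>\<^sup>+g. ennreal (exp (- u * (g * ((1 - y) / y)))) \<partial>G)
          = ennreal ((y / (y + u * (1 - y))) powr \<kappa>)"
        using AE
      proof eventually_elim
        case (elim y)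
        have "(1 / (1 + u * ((1 - y) / y))) = y / (y + u * (1 - y))" using elim by (simp add: field_simps)
        then show ?case using nnG[of "u * ((1 - y) / y)"] elim u by (simp add: mult_ac)
      qed
    qed
    also have "\<dots> = ennreal (\<integral>y. (y / (y + u * (1 - y))) powr \<kappa> \<partial>\<nu>)"
    proof (rule nn_integral_eq_integral)
      show "integrable \<nu> (\<lambda>y. (y / (y + u * (1 - y))) powr \<kappa>)"
      proof (rule \<nu>.integrable_const_bound[where B = 1])
        show "AE y in \<nu>. norm ((y / (y + u * (1 - y))) powr \<kappa>) \<le> 1"
          using AE
        proof eventually_elim
          case (elim y)
          have "0 \<le> u * (1 - y)" using u elim by simp
          then have "0 \<le> y / (y + u * (1 - y))" "y / (y + u * (1 - y)) \<le> 1"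
            using elim by (auto simp: divide_le_eq_1)
          then show ?case using powr_mono2[of \<kappa> "y / (y + u * (1 - y))" 1] \<kappa> by simp
        qed
      qed auto
    qed auto
    also have "\<dots> = ennreal (lap \<kappa>' H' u)" by (simp add: eq[OF u])
    finally have "(\<integral>\<theta>. exp (- u * \<theta>) \<partial>N) = lap \<kappa>' H' u"
      unfolding eq[OF u, symmetric] by (subst integral_eq_nn_integral) (auto intro!: integral_nonneg_AE)
    then show "(\<integral>\<theta>. exp (- u * \<theta>) \<partial>N) = (\<integral>\<theta>. exp (- u * \<theta>) \<partial>mixdist H' \<kappa>')"
      using laplace_mixdist[OF H', of u] u by simp
  qed (use N AEN real_distribution_mixdist[OF H'] in auto)
  \<comment> \<open>\<open>N\<close> equals a law with a density carried by the positive half-line,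
    so it does not charge 0. By Fubini, almost every y admits some g > 0 making the product
    positive, which forces y < 1.\<close>
  then have "AE \<theta> in N. 0 < \<theta>" using AE_mixdist[OF H'] by (simp only:)
  then have "AE x in \<nu> \<Otimes>\<^sub>M G. 0 < snd x * ((1 - fst x) / fst x)"
    unfolding N_def by (subst (asm) AE_distr_iff) (auto simp: case_prod_beta)
  then have "AE y in \<nu>. AE g in G. 0 < g * ((1 - y) / y)"
    using P.AE_pair by fastforce
  then show ?thesis
    using AE
  proof eventually_elim
    case (elim y)
    from elim(1) AEG have "AE g in G. 0 < g * ((1 - y) / y) \<and> 0 < g" by eventually_elim simp
    then obtain g where "0 < g * ((1 - y) / y)" "0 < g"
      using eventually_happens'[OF G.ae_filter_bot] by blast
    then show ?case using elim(2) by (simp add: zero_less_mult_iff zero_less_divide_iff)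
  qed
qed

text \<open>With both endpoints excluded, the inverse map y / (1 - y) carries the limit back to a
  genuine mixing measure on positive rates with the same transform.\<close>

lemma inG_if_limit:
  fixes \<nu> :: "real measure"
  assumes \<nu>: "real_distribution \<nu>" and AE: "AE y in \<nu>. 0 \<le> y \<and> y \<le> 1" and \<kappa>: "0 < \<kappa>"
    and H': "H' \<in> Ppos" "0 < \<kappa>'"
    and eq: "\<And>u. 0 < u \<Longrightarrow> u \<le> 1 \<Longrightarrow> (\<integral>y. (y / (y + u * (1 - y))) powr \<kappa> \<partial>\<nu>) = lap \<kappa>' H' u"
  shows "inG \<kappa> (gmix H' \<kappa>')"
proof -
  interpret \<nu>: real_distribution \<nu> by fact
  have "AE y in \<nu>. 0 < y"
    using lap_tendsto_1[OF H'] eq[of "1 / real (Suc _)"]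
    by (intro limit_no_atom_at_0[OF \<nu> AE \<kappa>]) simp
  then have AE': "AE y in \<nu>. 0 < y \<and> y \<le> 1" using AE by eventually_elim auto
  moreover have "AE y in \<nu>. y < 1" by (rule limit_no_atom_at_1[OF \<nu> AE' \<kappa> H' eq])
  ultimately have AE'': "AE y in \<nu>. 0 < y \<and> y < 1" by eventually_elim auto
  define H where "H = distr \<nu> borel (\<lambda>y. y / (1 - y))"
  have "prob_space H" unfolding H_def by (intro \<nu>.prob_space_distr) measurable
  moreover have "AE y in \<nu>. 0 < y / (1 - y)" using AE'' by eventually_elim simp
  then have "AE x in H. 0 < x"
    unfolding H_def by (subst AE_distr_iff) auto
  moreover have "sets H = sets borel" by (simp add: H_def)
  ultimately have H: "H \<in> Ppos" by (simp add: Ppos_def)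
  show ?thesis
  proof (rule inG_if_lap_eq[OF H \<kappa> H'])
    fix u :: real assume u: "0 < u" "u \<le> 1"
    have "lap \<kappa> H u = (\<integral>y. (y / (1 - y) / (y / (1 - y) + u)) powr \<kappa> \<partial>\<nu>)"
      unfolding lap_def H_def by (subst integral_distr) auto
    also have "\<dots> = (\<integral>y. (y / (y + u * (1 - y))) powr \<kappa> \<partial>\<nu>)"
    proof (rule integral_cong_AE)
      show "AE y in \<nu>. (y / (1 - y) / (y / (1 - y) + u)) powr \<kappa> = (y / (y + u * (1 - y))) powr \<kappa>"
        using AE''
      proof eventually_elim
        case (elim y)
        have "y / (1 - y) + u = (y + u * (1 - y)) / (1 - y)" using elim by (simp add: field_simps)
        then show ?case using elim by simp
      qed
    qed auto
    finally show "lap \<kappa> H u = lap \<kappa>' H' u" using eq[OF u] by simp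
  qed
qed

text \<open>Closedness of the families under convergence of shapes and transforms; the positivity of
  the limit shape is part of the conclusion.\<close>

lemma inG_pos_of_lap_limit:
  fixes H :: "nat \<Rightarrow> real measure"
  assumes H: "\<And>j. H j \<in> Ppos" and k: "\<And>j. 0 < k j" "k \<longlonglongrightarrow> \<kappa>" 
    and H': "H' \<in> Ppos" "0 < \<kappa>'"
    and lim: "\<And>u. 0 < u \<Longrightarrow> u \<le> 1 \<Longrightarrow> (\<lambda>j. lap (k j) (H j) u) \<longlonglongrightarrow> lap \<kappa>' H' u"
  shows "0 < \<kappa> \<and> inG \<kappa> (gmix H' \<kappa>')"
proof
  show "0 < \<kappa>"
  proof (rule ccontr)
    assume "\<not> 0 < \<kappa>"
    then have "\<kappa> = 0" using LIMSEQ_le_const[OF k(2), of 0] k(1) by (force intro: less_imp_le)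
    then have "(\<lambda>j. 1 - (1/2) powr k j) \<longlonglongrightarrow> 1 - (1/2) powr 0"
      using k(2) by (intro tendsto_intros) auto
    moreover have "(\<lambda>j. lap (k j) (H j) (1/2) - lap (k j) (H j) 1) \<longlonglongrightarrow> lap \<kappa>' H' (1/2) - lap \<kappa>' H' 1"
      by (intro tendsto_diff lim) auto
    ultimately have "lap \<kappa>' H' (1/2) - lap \<kappa>' H' 1 \<le> 1 - (1/2) powr 0"
      using lap_diff_le_shape[OF H k(1)] by (intro LIMSEQ_le) auto
    then show False using lap_strict_antimono[OF H', of "1/2" 1] by simp
  qed
  from lap_subsequential_limit[OF H k this lim] inG_if_limit[OF _ _ this H']
  show "inG \<kappa> (gmix H' \<kappa>')" by metis
qed

text \<open>Otherwise pairs with distance below 1/(n + 1) exist, and compactness of [0, K] gives a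
  limit shape at most \<open>K\<close> that represents the true density, against
  \<open>K < kappa0\<close>. The constant \<open>d\<close> is uniform in shape and mixing
  measure.\<close>

lemma dKS_bounded_away:
  assumes H': "H' \<in> Ppos" "0 < \<kappa>'" and K: "K < kappa0 H' \<kappa>'"
  obtains d where "0 < d" "\<And>\<kappa> H. 0 < \<kappa> \<Longrightarrow> \<kappa> \<le> K \<Longrightarrow> H \<in> Ppos \<Longrightarrow> d \<le> dKS (Fmix H \<kappa>) (Fmix H' \<kappa>')"
proof (rule ccontr)
  assume no: "\<not> thesis"
  note d_thesis = that
  have "\<exists>\<kappa> H. 0 < \<kappa> \<and> \<kappa> \<le> K \<and> H \<in> Ppos \<and> dKS (Fmix H \<kappa>) (Fmix H' \<kappa>') < d" if "0 < d" for d
  proof (rule ccontr)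
    assume "\<not> ?thesis"
    then have thesis using that by (intro d_thesis[of d]) (auto simp: not_less)
    with no show False ..
  qed
  then have "\<forall>n. \<exists>\<kappa> H. 0 < \<kappa> \<and> \<kappa> \<le> K \<and> H \<in> Ppos \<and> dKS (Fmix H \<kappa>) (Fmix H' \<kappa>') < 1 / real (Suc n)"
    by simp
  then obtain k H where k: "\<And>n. 0 < k n" "\<And>n. k n \<le> K" and H: "\<And>n. H n \<in> Ppos"
    and d: "\<And>n. dKS (Fmix (H n) (k n)) (Fmix H' \<kappa>') < 1 / real (Suc n)"
    by metis
  have "compact {0..K}" "\<forall>n. k n \<in> {0..K}" using k by (auto intro: less_imp_le)
  then obtain \<kappa> r where r: "\<kappa> \<in> {0..K}" "strict_mono r" "(k \<circ> r) \<longlonglongrightarrow> \<kappa>"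
    unfolding compact_def by blast
  have lim: "(\<lambda>n. lap (k n) (H n) u) \<longlonglongrightarrow> lap \<kappa>' H' u" if u: "0 < u" "u \<le> 1" for u
  proof (rule LIM_zero_cancel, rule Lim_null_comparison)
    show "eventually (\<lambda>n. norm (lap (k n) (H n) u - lap \<kappa>' H' u) \<le> 1 / real (Suc n)) sequentially"
    proof (intro always_eventually allI)
      show "norm (lap (k n) (H n) u - lap \<kappa>' H' u) \<le> 1 / real (Suc n)" for n
        using lap_diff_le_dKS[OF H k(1) H' u, of n n] d[of n] by simp
    qed
    show "(\<lambda>n. 1 / real (Suc n)) \<longlonglongrightarrow> 0" by (rule LIMSEQ_Suc[OF lim_1_over_n])
  qed
  have "0 < \<kappa> \<and> inG \<kappa> (gmix H' \<kappa>')"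
  proof (rule inG_pos_of_lap_limit[where H = "\<lambda>n. H (r n)" and k = "\<lambda>n. k (r n)"])
    show "(\<lambda>n. k (r n)) \<longlonglongrightarrow> \<kappa>" using r(3) by (simp add: comp_def)
    show "(\<lambda>j. lap (k (r j)) (H (r j)) u) \<longlonglongrightarrow> lap \<kappa>' H' u" if "0 < u" "u \<le> 1" for u
      using LIMSEQ_subseq_LIMSEQ[OF lim[OF that] r(2)] by (simp add: comp_def)
  qed (use H k H' in auto)
  then have "kappa0 H' \<kappa>' \<le> \<kappa>"
    unfolding kappa0_def by (intro cInf_lower bdd_belowI[of _ 0]) auto
  then show False using K r(1) by simp
qed

section \<open>Consistency from Kolmogorov--Smirnov closeness\<close>

lemma dKS_commute: "dKS F G = dKS G F"
  by (simp add: dKS_def abs_minus_commute)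



lemma dKS_triangle:
  assumes "\<And>m. \<bar>F m - G m\<bar> \<le> A" "\<And>m. \<bar>G m - K m\<bar> \<le> B"
  shows "dKS F K \<le> dKS F G + dKS G K"
proof (rule dKS_least)
  show "\<bar>F m - K m\<bar> \<le> dKS F G + dKS G K" for m
    using dKS_upper[of F G A m, OF assms(1)] dKS_upper[of G K B m, OF assms(2)] by linarith
qed

text \<open>The deterministic core, for any [0, 1]-valued sequence in place of the empirical one.
  Admissible shapes reproduce the true distribution and are accepted; the positive gap below
  \<open>kappa0\<close> rejects smaller shapes.\<close>

lemma Inf_delta_n_tendsto:
  assumes Hs: "Hs \<in> Ppos" "0 < \<kappa>s"
    and Fe: "\<And>n m. 0 \<le> Fe n m" "\<And>n m. Fe n m \<le> 1"
    and \<eta>: "\<eta> \<longlonglongrightarrow> 0" "eventually (\<lambda>n. 0 < \<eta> n) sequentially"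
    and close: "eventually (\<lambda>n. dKS (Fe n) (Fmix Hs \<kappa>s) \<le> \<eta> n) sequentially"
  shows "(\<lambda>n. Inf {\<kappa>. 0 < \<kappa> \<and> delta_n (Fe n) \<kappa> \<le> \<eta> n}) \<longlonglongrightarrow> kappa0 Hs \<kappa>s"
proof -
  define S where "S = {\<kappa>. 0 < \<kappa> \<and> inG \<kappa> (gmix Hs \<kappa>s)}"
  define T where "T n = {\<kappa>. 0 < \<kappa> \<and> delta_n (Fe n) \<kappa> \<le> \<eta> n}" for n
  have near: "\<bar>Fmix H \<kappa> m - Fe n m\<bar> \<le> 1" if "H \<in> Ppos" "0 < \<kappa>" for H \<kappa> m n
    using Fmix_bounds[OF that, of m] Fe(1,2)[of n m] by (simp add: abs_le_iff)
  have bdd: "bdd_below ((\<lambda>H. dKS (Fmix H \<kappa>) (Fe n)) ` Ppos)" if "0 < \<kappa>" for \<kappa> n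
  proof (rule bdd_belowI2)
    fix H assume "H \<in> Ppos"
    then show "0 \<le> dKS (Fmix H \<kappa>) (Fe n)"
      using dKS_upper[of "Fmix H \<kappa>" "Fe n" 1 0] near[OF _ that] by (meson abs_ge_zero order_trans)
  qed
  have T_bdd: "bdd_below (T n)" for n by (rule bdd_belowI[of _ 0]) (auto simp: T_def)
  have ST: "\<kappa> \<in> T n" if "\<kappa> \<in> S" "dKS (Fe n) (Fmix Hs \<kappa>s) \<le> \<eta> n" for \<kappa> n
  proof -
    obtain H where H: "H \<in> Ppos" "\<And>\<theta>. 0 < \<theta> \<Longrightarrow> gmix Hs \<kappa>s \<theta> = gmix H \<kappa> \<theta>" and \<kappa>: "0 < \<kappa>"
      using \<open>\<kappa> \<in> S\<close> by (auto simp: S_def inG_def)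
    have "fmix Hs \<kappa>s = fmix H \<kappa>" by (rule fmix_cong_gmix[OF Hs H(1) \<kappa> H(2)])
    then have "Fmix H \<kappa> = Fmix Hs \<kappa>s" by (simp add: Fmix_def fun_eq_iff)
    then have "dKS (Fmix H \<kappa>) (Fe n) \<le> \<eta> n" using that(2) by (simp add: dKS_commute)
    then have "delta_n (Fe n) \<kappa> \<le> \<eta> n"
      unfolding delta_n_def by (rule order_trans[OF cINF_lower[OF bdd[OF \<kappa>] H(1)]])
    with \<kappa> show ?thesis by (simp add: T_def)
  qed
  have "\<kappa>s \<in> S" using Hs by (auto simp: S_def inG_def)
  have k0: "kappa0 Hs \<kappa>s = Inf S" by (simp add: kappa0_def S_def)
  have "(\<lambda>n. Inf (T n)) \<longlonglongrightarrow> kappa0 Hs \<kappa>s"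
  proof (rule order_tendstoI)
    fix a assume a: "a < kappa0 Hs \<kappa>s"
    then obtain K where K: "a < K" "K < kappa0 Hs \<kappa>s" using dense by blast
    from dKS_bounded_away[OF Hs K(2)] obtain d where d: "0 < d"
      "\<And>\<kappa> H. 0 < \<kappa> \<Longrightarrow> \<kappa> \<le> K \<Longrightarrow> H \<in> Ppos \<Longrightarrow> d \<le> dKS (Fmix H \<kappa>) (Fmix Hs \<kappa>s)" by metis
    \<comment> \<open>Of the three thirds, two pay for an almost optimal mixing measure and one for
      the distance to the truth.\<close>
    have "eventually (\<lambda>n. \<eta> n < d / 3) sequentially"
      using order_tendstoD(2)[OF \<eta>(1), of "d / 3"] d by simp
    with \<eta>(2) close show "eventually (\<lambda>n. a < Inf (T n)) sequentially"
    proof eventually_elim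
      case (elim n)
      have "K \<le> \<kappa>" if "\<kappa> \<in> T n" for \<kappa>
      proof (rule ccontr)
        assume "\<not> K \<le> \<kappa>"
        \<comment> \<open>The infimum in \<open>delta_n\<close> need not be attained; positivity of
          \<eta> makes this inequality strict, so some measure achieves 2\<eta>.\<close>
        have \<kappa>: "0 < \<kappa>" "delta_n (Fe n) \<kappa> < 2 * \<eta> n" using that elim by (auto simp: T_def)
        moreover have "Ppos \<noteq> {}" using Hs by auto
        ultimately obtain H where H: "H \<in> Ppos" "dKS (Fmix H \<kappa>) (Fe n) < 2 * \<eta> n"
          unfolding delta_n_def using cINF_less_iff[OF _ bdd[OF \<kappa>(1)]] by auto
        have "d \<le> dKS (Fmix H \<kappa>) (Fmix Hs \<kappa>s)"
          using \<open>\<not> K \<le> \<kappa>\<close> by (intro d H \<kappa>) auto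
        also have "\<dots> \<le> dKS (Fmix H \<kappa>) (Fe n) + dKS (Fe n) (Fmix Hs \<kappa>s)"
          by (rule dKS_triangle[OF near[OF H(1) \<kappa>(1)]])
            (use near[OF Hs] in \<open>simp add: abs_minus_commute\<close>)
        also have "\<dots> < d" using H elim by simp
        finally show False by simp
      qed
      \<comment> \<open>The true shape lies in \<open>T n\<close>, so the infimum is over a nonempty
        set.\<close>
      then have "K \<le> Inf (T n)" using ST[OF \<open>\<kappa>s \<in> S\<close> elim(2)] by (intro cInf_greatest) auto
      then show ?case using K by simp
    qed
  next
    fix a assume "kappa0 Hs \<kappa>s < a"
    then obtain \<kappa> where \<kappa>: "\<kappa> \<in> S" "\<kappa> < a"
      unfolding k0 using cInf_lessD[of S a] \<open>\<kappa>s \<in> S\<close> by auto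
    show "eventually (\<lambda>n. Inf (T n) < a) sequentially"
      using close
    proof eventually_elim
      case (elim n)
      then show ?case using cInf_lower[OF ST[OF \<kappa>(1) elim] T_bdd] \<kappa>(2) by simp
    qed
  qed
  then show ?thesis by (simp add: T_def)
qed

section \<open>A Kolmogorov--Smirnov rate for empirical distributions\<close>

text \<open>Between consecutive quantiles of level j/N, \<open>F\<close> moves by at most 1/N, and
  monotonicity traps \<open>E\<close> between its values at grid points. The grid is independent of
  \<open>E\<close>, as a union bound requires.\<close>

lemma quantile_grid:
  fixes F :: "nat \<Rightarrow> real" and N :: nat
  assumes F: "mono F" "F \<longlonglongrightarrow> 1" "\<And>m. 0 \<le> F m" and N: "0 < N"
  shows "\<exists>Q. finite Q \<and> card Q \<le> 2 * N \<and>
    (\<forall>E t m. mono E \<longrightarrow> (\<forall>m. 0 \<le> E m \<and> E m \<le> 1) \<longrightarrow> 0 \<le> t \<longrightarrow>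
       (\<forall>m\<in>Q. \<bar>E m - F m\<bar> \<le> t) \<longrightarrow> \<bar>E m - F m\<bar> \<le> t + 1 / real N)"
proof -
  define q where "q j = (LEAST m. real j / real N \<le> F m)" for j
  \<comment> \<open>The predecessors of the quantiles play the role of left limits, which control
    \<open>E\<close> just before a large jump of \<open>F\<close>.\<close>
  define Q where "Q = q ` {1..<N} \<union> (\<lambda>j. q j - 1) ` {1..<N}"
  have F1: "F m \<le> 1" for m using F(1,2) by (intro incseq_le) auto
  have q: "real j / real N \<le> F (q j)" if "j < N" for j
  proof -
    have "real j / real N < 1" using that N by simp
    from order_tendstoD(1)[OF F(2) this] obtain m where "real j / real N \<le> F m"
      by (auto simp: eventually_sequentially intro: less_imp_le)
    then show ?thesis unfolding q_def by (rule LeastI)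
  qed
  have q_le: "q j \<le> m" if "real j / real N \<le> F m" for j m
    unfolding q_def using that by (rule Least_le)
  show ?thesis
  proof (intro exI[of _ Q] conjI allI impI)
    show "finite Q" by (simp add: Q_def)
    have "card Q \<le> card (q ` {1..<N}) + card ((\<lambda>j. q j - 1) ` {1..<N})"
      unfolding Q_def by (rule card_Un_le)
    also have "\<dots> \<le> card {1..<N} + card {1..<N}" by (intro add_mono card_image_le) auto
    finally show "card Q \<le> 2 * N" by simp
  next
    fix E :: "nat \<Rightarrow> real" and t :: real and m :: nat
    assume "mono E" "\<forall>m. 0 \<le> E m \<and> E m \<le> 1" and t: "0 \<le> t" and "\<forall>m\<in>Q. \<bar>E m - F m\<bar> \<le> t"
    then have E: "mono E" "\<And>m. 0 \<le> E m \<and> E m \<le> 1" and close: "\<And>m. m \<in> Q \<Longrightarrow> \<bar>E m - F m\<bar> \<le> t"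
      by auto
    \<comment> \<open>\<open>j\<close> is the level block containing F(m). The cap at N - 1 puts the
      value 1 into the last block, since level 1 may have no quantile.\<close>
    define j where "j = min (nat \<lfloor>real N * F m\<rfloor>) (N - 1)"
    have "0 \<le> real N * F m" using F(3) by simp
    then have "real j \<le> real N * F m" by (simp add: j_def min_def) linarith
    then have jF: "real j / real N \<le> F m" using N by (simp add: field_simps)
    have "real N * F m \<le> real (j + 1)"
    proof (cases "nat \<lfloor>real N * F m\<rfloor> \<le> N - 1")
      case True
      then show ?thesis using \<open>0 \<le> real N * F m\<close> by (simp add: j_def min_def) linarith
    next
      case False
      then show ?thesis using N F1[of m] mult_left_mono[of "F m" 1 "real N"] by (simp add: j_def min_def)
    qed
    then have Fj: "F m \<le> real j / real N + 1 / real N" using N by (simp add: field_simps)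
    have lower: "real j / real N - t \<le> E m"
    proof (cases "j = 0")
      case True
      then have "real j / real N = 0" by simp
      then show ?thesis using E(2)[of m] t by linarith
    next
      case False
      moreover have "j \<le> N - 1" by (simp add: j_def)
      ultimately have j: "j \<in> {1..<N}" using N by simp
      have "real j / real N - t \<le> E (q j)"
        using q[of j] close[of "q j"] j by (auto simp: Q_def abs_le_iff) 
      also have "\<dots> \<le> E m" by (rule monoD[OF E(1) q_le[OF jF]])
      finally show ?thesis .
    qed
    have upper: "E m \<le> real j / real N + 1 / real N + t"
    proof (cases "j + 1 < N \<and> F m < real (j + 1) / real N")
      case True
      then have j: "j + 1 \<in> {1..<N}" by simp
      have "m < q (j + 1)"
        using q[of "j + 1"] True monoD[OF F(1), of "q (j + 1)" m] by (auto simp: not_le[symmetric])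
      then have "q (j + 1) - 1 < q (j + 1)" and m: "m \<le> q (j + 1) - 1" by auto
      then have "F (q (j + 1) - 1) < real (j + 1) / real N"
        using q_le[of "j + 1" "q (j + 1) - 1"] by force
      have "E m \<le> E (q (j + 1) - 1)" by (rule monoD[OF E(1) m])
      also have "\<dots> \<le> F (q (j + 1) - 1) + t"
        using close[of "q (j + 1) - 1"] j by (auto simp: Q_def abs_le_iff algebra_simps)
      finally show ?thesis using \<open>F (q (j + 1) - 1) < real (j + 1) / real N\<close> by (simp add: add_divide_distrib)
    next
      case False
      show ?thesis
      proof (cases "j + 1 < N")
        case True
        \<comment> \<open>This case is contradictory: below the cap, \<open>j\<close> is the floor
          of N F(m). In the remaining case j = N - 1, and \<open>E\<close> \<le> 1 suffices.\<close>
        with False have "real (j + 1) \<le> real N * F m" using N by (simp add: field_simps)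
        then have "j + 1 \<le> nat \<lfloor>real N * F m\<rfloor>" by (simp add: le_nat_floor)
        then show ?thesis using True unfolding j_def by linarith
      next
        case False
        then have "real j + 1 = real N" using N by (simp add: j_def)
        then have "real j / real N + 1 / real N = 1" using N by (simp add: add_divide_distrib[symmetric])
        then show ?thesis using E(2)[of m] t by simp
      qed
    qed
    show "\<bar>E m - F m\<bar> \<le> t + 1 / real N" using lower upper jF Fj by (simp add: abs_le_iff)
  qed
qed

section \<open>Deviations of the empirical distribution function\<close>

lemma empF_sum: "real n * empF X n \<omega> m = (\<Sum>i<n. indicator {..m} (X i \<omega>))"
proof -
  have "(\<Sum>i<n. indicator {..m} (X i \<omega>)) = (\<Sum>i<n. if X i \<omega> \<le> m then 1 else 0 :: real)"
    by (intro sum.cong) (auto simp: indicator_def)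
  also have "\<dots> = real (card {i. i < n \<and> X i \<omega> \<le> m})"
    by (simp add: sum.If_cases Int_def lessThan_def)
  finally show ?thesis by (simp add: empF_def)
qed

lemma empF_bounds: "0 \<le> empF X n \<omega> m" "empF X n \<omega> m \<le> 1"
proof -
  have "card {i. i < n \<and> X i \<omega> \<le> m} \<le> card {..<n}" by (intro card_mono) auto
  then show "empF X n \<omega> m \<le> 1" by (cases "n = 0") (simp_all add: empF_def)
qed (simp add: empF_def)

lemma mono_empF: "mono (empF X n \<omega>)"
  unfolding empF_def by (intro monoI divide_right_mono of_nat_mono card_mono) auto

text \<open>Each further observation changes the unnormalised deviation by at most 1. This transfers
  bounds from a sample size to larger ones nearby.\<close>

lemma empF_increment:
  assumes "k \<le> n" and G: "0 \<le> G" "G \<le> 1"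
  shows "real n * \<bar>empF X n \<omega> m - G\<bar> \<le> real k * \<bar>empF X k \<omega> m - G\<bar> + real (n - k)"
proof -
  have "real n * (empF X n \<omega> m - G) = (\<Sum>i<n. indicator {..m} (X i \<omega>) - G)" for n
    by (simp add: right_diff_distrib empF_sum sum_subtractf)
  note eq = this
  have "{..<n} = {..<k} \<union> {k..<n}" "{..<k} \<inter> {k..<n} = {}" using \<open>k \<le> n\<close> by auto
  then have "real n * (empF X n \<omega> m - G) = real k * (empF X k \<omega> m - G) + (\<Sum>i=k..<n. indicator {..m} (X i \<omega>) - G)"
    unfolding eq by (simp add: sum.union_disjoint)
  moreover have "\<bar>\<Sum>i=k..<n. indicator {..m} (X i \<omega>) - G\<bar> \<le> (\<Sum>i=k..<n. 1)"
    using G by (intro sum_abs[THEN order_trans] sum_mono) (auto simp: indicator_def)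
  ultimately have "\<bar>real n * (empF X n \<omega> m - G)\<bar> \<le> \<bar>real k * (empF X k \<omega> m - G)\<bar> + real (n - k)"
    by simp
  then show ?thesis by (simp add: abs_mult)
qed

lemma (in prob_space) measurable_empF:
  assumes [measurable]: "\<And>i. X i \<in> measurable M (count_space UNIV)"
  shows "(\<lambda>\<omega>. empF X n \<omega> m) \<in> borel_measurable M"
proof -
  have "(\<lambda>\<omega>. empF X n \<omega> m) = (\<lambda>\<omega>. (\<Sum>i<n. indicator {..m} (X i \<omega>)) / real n)"
    by (cases "n = 0") (auto simp: fun_eq_iff field_simps empF_sum[symmetric], simp add: empF_def)
  also have "\<dots> \<in> borel_measurable M"
    by (intro borel_measurable_divide borel_measurable_sum borel_measurable_const
      measurable_compose[OF assms]) simp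
  finally show ?thesis .
qed

text \<open>Hoeffding's inequality for sums of independent indicators.\<close>

lemma (in prob_space) empF_tail:
  assumes X[measurable]: "\<And>i. X i \<in> measurable M (count_space UNIV)"
    and ind: "indep_vars (\<lambda>_. count_space UNIV) X UNIV"
    and F: "\<And>i. prob {\<omega> \<in> space M. X i \<omega> \<le> m} = F"
    and n: "0 < n" and t: "0 \<le> t"
  shows "prob {\<omega> \<in> space M. t \<le> \<bar>empF X n \<omega> m - F\<bar>} \<le> 2 * exp (- 2 * real n * t\<^sup>2)"
proof -
  let ?Z = "\<lambda>i \<omega>. indicator {..m} (X i \<omega>) :: real"
  have E: "expectation (?Z i) = F" for i
  proof -
    have "expectation (?Z i) = expectation (indicator {\<omega> \<in> space M. X i \<omega> \<le> m})"
      by (intro Bochner_Integration.integral_cong) (auto simp: indicator_def)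
    also have "\<dots> = F" by (subst F[of i, symmetric]) simp
    finally show ?thesis .
  qed
  interpret H: Hoeffding_ineq M "{..<n}" ?Z "\<lambda>_. 0" "\<lambda>_. 1" "real n * F"
  proof unfold_locales
    show "indep_vars (\<lambda>_. borel) ?Z {..<n}"
      by (rule indep_vars_compose2[OF indep_vars_subset[OF ind]]) auto
    show "real n * F \<equiv> \<Sum>i<n. expectation (?Z i)" by (simp add: E)
  qed (auto simp: indicator_def)
  have "{\<omega> \<in> space M. t \<le> \<bar>empF X n \<omega> m - F\<bar>} = {\<omega> \<in> space M. real n * t \<le> \<bar>(\<Sum>i<n. ?Z i \<omega>) - real n * F\<bar>}"
  proof -
    have "(\<Sum>i<n. ?Z i \<omega>) - real n * F = real n * (empF X n \<omega> m - F)" for \<omega>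
      by (simp add: empF_sum right_diff_distrib)
    then show ?thesis using n by (simp add: abs_mult)
  qed
  also have "prob \<dots> \<le> 2 * exp (- 2 * (real n * t)\<^sup>2 / (\<Sum>i<n. (1 - 0)\<^sup>2))"
    using n t by (intro H.Hoeffding_ineq_abs_ge) auto
  also have "\<dots> = 2 * exp (- 2 * real n * t\<^sup>2)"
    using n by (simp add: power_mult_distrib power2_eq_square)
  finally show ?thesis .
qed

text \<open>Along the squares \<open>n = k\<^sup>2\<close> the union bound over \<open>k\<close> quantiles is summable as soon as
  \<open>4 c\<^sup>2 > 2\<close>; between \<open>k\<^sup>2\<close> and \<open>(k + 1)\<^sup>2\<close> the unnormalised deviation moves by at most
  \<open>2 k\<close>, which is negligible against \<open>k sqrt (ln k)\<close>. Neither the sharp constant in the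
  Dvoretzky--Kiefer--Wolfowitz inequality nor a maximal inequality is needed.\<close>

lemma (in prob_space) empF_deviation:
  assumes X[measurable]: "\<And>i. X i \<in> measurable M (count_space UNIV)"
    and ind: "indep_vars (\<lambda>_. count_space UNIV) X UNIV"
    and F: "\<And>i m. prob {\<omega> \<in> space M. X i \<omega> \<le> m} = F m"
    and C: "1 / sqrt 2 < C"
  shows "AE \<omega> in M. eventually (\<lambda>n. dKS (empF X n \<omega>) F \<le> C * sqrt (ln (real n) / real n)) sequentially"
proof -
  note [measurable] = measurable_empF[OF X]
  have F01: "0 \<le> F m" "F m \<le> 1" for m by (simp_all flip: F[of 0])
  have "mono F"
    by (intro monoI) (auto simp flip: F[of 0] intro!: finite_measure_mono)
  have "F \<longlonglongrightarrow> 1"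
  proof -
    have "(\<lambda>m. prob {\<omega> \<in> space M. X 0 \<omega> \<le> m}) \<longlonglongrightarrow> prob (\<Union>m. {\<omega> \<in> space M. X 0 \<omega> \<le> m})"
      by (intro finite_Lim_measure_incseq) (auto simp: incseq_def)
    moreover have "(\<Union>m. {\<omega> \<in> space M. X 0 \<omega> \<le> m}) = space M" by auto
    ultimately show ?thesis by (simp add: F prob_space)
  qed
  \<comment> \<open>The slack C - c absorbs the grid error and the gaps between squares.\<close>
  obtain c where c: "1 / sqrt 2 < c" "c < C" using dense[OF C] by blast
  have "0 < 1 / sqrt (2::real)" by simp
  then have c0: "0 < c" using c(1) by linarith
  have c2: "1 / 2 < c\<^sup>2" using power_strict_mono[OF c(1), of 2] by (simp add: power_divide)
  \<comment> \<open>This is c sqrt(ln n / n) at the sample size n = k^2.\<close>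
  define t where "t k = c * sqrt (2 * ln (real k)) / real k" for k
  have t: "0 \<le> t k" for k using c0 by (cases "k = 0") (auto simp: t_def)
  define good where "good k Q \<longleftrightarrow> finite Q \<and> card Q \<le> 2 * k \<and>
    (\<forall>E t m. mono E \<longrightarrow> (\<forall>m. 0 \<le> E m \<and> E m \<le> 1) \<longrightarrow> 0 \<le> t \<longrightarrow>
       (\<forall>m\<in>Q. \<bar>E m - F m\<bar> \<le> t) \<longrightarrow> \<bar>E m - F m\<bar> \<le> t + 1 / real k)" for k Q
  have "\<exists>Q. good k Q" if "0 < k" for k
    unfolding good_def by (rule quantile_grid[OF \<open>mono F\<close> \<open>F \<longlonglongrightarrow> 1\<close> F01(1) that])
  then obtain Q where Q': "\<And>k. 0 < k \<Longrightarrow> good k (Q k)" by metis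
  then have Q: "finite (Q k)" "card (Q k) \<le> 2 * k" if "0 < k" for k
    using that by (simp_all add: good_def)
  have grid: "\<bar>E m - F m\<bar> \<le> t + 1 / real k"
    if "0 < k" "mono E" "\<And>m. 0 \<le> E m \<and> E m \<le> 1" "0 \<le> t" "\<And>m. m \<in> Q k \<Longrightarrow> \<bar>E m - F m\<bar> \<le> t" for k E t m
    using Q'[OF that(1)] that(2-5) unfolding good_def by simp
  define A where "A k = (\<Union>m\<in>Q k. {\<omega> \<in> space M. t k \<le> \<bar>empF X (k\<^sup>2) \<omega> m - F m\<bar>})" for k
  have A_le: "prob (A k) \<le> 4 * real k powr (1 - 4 * c\<^sup>2)" if k: "0 < k" for k
  proof -
    have "prob (A k) \<le> (\<Sum>m\<in>Q k. prob {\<omega> \<in> space M. t k \<le> \<bar>empF X (k\<^sup>2) \<omega> m - F m\<bar>})"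
      unfolding A_def by (intro measure_UNION_le Q k) measurable
    also have "\<dots> \<le> (\<Sum>m\<in>Q k. 2 * exp (- 2 * real (k\<^sup>2) * (t k)\<^sup>2))"
      using k by (intro sum_mono empF_tail X ind F t) simp
    also have "\<dots> \<le> real (2 * k) * (2 * exp (- 2 * real (k\<^sup>2) * (t k)\<^sup>2))"
      unfolding sum_constant using Q(2)[OF k] by (intro mult_right_mono) (simp_all only: of_nat_le_iff, simp)
    also have "- 2 * real (k\<^sup>2) * (t k)\<^sup>2 = - 4 * c\<^sup>2 * ln (real k)"
      using k by (simp add: t_def power_divide power_mult_distrib)
    also have "real (2 * k) * (2 * exp (- 4 * c\<^sup>2 * ln (real k))) = 4 * real k powr (1 - 4 * c\<^sup>2)"
      using k by (simp add: powr_def exp_diff exp_minus left_diff_distrib field_simps)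
    finally show ?thesis .
  qed
  \<comment> \<open>The index is shifted because the grid exists only for k > 0.\<close>
  have "AE \<omega> in M. eventually (\<lambda>k. \<omega> \<in> space M - A (Suc k)) sequentially"
  proof (rule borel_cantelli_AE1)
    show "A (Suc k) \<in> events" for k
      unfolding A_def by (intro sets.finite_UN Q) (simp, measurable)
    have "summable (\<lambda>k. 4 * real k powr (1 - 4 * c\<^sup>2))"
      using c2 by (intro summable_mult) (simp add: summable_real_powr_iff)
    then have "summable (\<lambda>k. 4 * real (Suc k) powr (1 - 4 * c\<^sup>2))"
      by (subst summable_Suc_iff)
    then show "summable (\<lambda>k. prob (A (Suc k)))"
    proof (rule summable_comparison_test')
      show "norm (prob (A (Suc k))) \<le> 4 * real (Suc k) powr (1 - 4 * c\<^sup>2)" for k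
        using A_le[of "Suc k"] by simp
    qed
  qed (simp add: less_top[symmetric])
  then show ?thesis
    using AE_space
  proof eventually_elim
    case (elim \<omega>)
    have ev1: "eventually (\<lambda>k. \<omega> \<notin> A k) sequentially"
      using elim(1) unfolding eventually_sequentially_Suc[of "\<lambda>k. \<omega> \<notin> A k", symmetric]
      by (auto elim: eventually_mono)
    \<comment> \<open>The 3 collects one k from the grid error, k^2 times 1/k, and 2k from n - k^2
      \<le> 2k.\<close>
    have ev2: "eventually (\<lambda>k. 3 \<le> (C - c) * sqrt (2 * ln (real k))) sequentially"
      using c by real_asymp
    have "eventually (\<lambda>k. \<forall>n. k\<^sup>2 \<le> n \<longrightarrow> n < (Suc k)\<^sup>2 \<longrightarrow> dKS (empF X n \<omega>) F \<le> C * sqrt (ln (real n) / real n)) sequentially"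
      using ev1 ev2 eventually_gt_at_top[of 0]
    proof eventually_elim
      case (elim k)
      show ?case
      proof (intro allI impI)
        fix n assume n: "k\<^sup>2 \<le> n" "n < (Suc k)\<^sup>2"
        have "0 < n" using n(1) elim(3) by (metis gr0I le_zero_eq power_eq_0_iff not_less0)
        have kn: "real k ^ 2 \<le> real n" using n(1) by (metis of_nat_le_iff of_nat_power)
        have "real k * sqrt (2 * ln (real k)) \<le> sqrt (real n * ln (real n))"
        proof (rule real_le_rsqrt)
          have "2 * ln (real k) = ln (real k ^ 2)" using elim(3) by (simp add: ln_realpow)
          also have "\<dots> \<le> ln (real n)"
            using kn elim(3) \<open>0 < n\<close> by (intro ln_le_cancel_iff[THEN iffD2]) (simp_all only: zero_less_power of_nat_0_less_iff)
          finally have "(real k)\<^sup>2 * (2 * ln (real k)) \<le> real n * ln (real n)"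
            using kn elim(3) by (intro mult_mono) auto
          then show "(real k * sqrt (2 * ln (real k)))\<^sup>2 \<le> real n * ln (real n)"
            using elim(3) by (simp add: power_mult_distrib)
        qed
        then have main: "C * (real k * sqrt (2 * ln (real k))) \<le> C * sqrt (real n * ln (real n))"
          using c c0 by (intro mult_left_mono) auto
        show "dKS (empF X n \<omega>) F \<le> C * sqrt (ln (real n) / real n)"
          unfolding dKS_def
        proof (rule cSUP_least)
          fix m
          have "\<bar>empF X (k\<^sup>2) \<omega> m - F m\<bar> \<le> t k + 1 / real k"
          proof (rule grid[OF elim(3) mono_empF _ t])
            show "\<bar>empF X (k\<^sup>2) \<omega> m - F m\<bar> \<le> t k" if "m \<in> Q k" for m
              using elim(1) that \<open>\<omega> \<in> space M\<close> by (force simp: A_def)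
          qed (simp add: empF_bounds)
          then have "real (k\<^sup>2) * \<bar>empF X (k\<^sup>2) \<omega> m - F m\<bar> \<le> real (k\<^sup>2) * (t k + 1 / real k)"
            by (intro mult_left_mono) auto
          also have "\<dots> = c * (real k * sqrt (2 * ln (real k))) + real k"
            using elim(3) by (simp add: t_def power2_eq_square field_simps)
          finally have "real n * \<bar>empF X n \<omega> m - F m\<bar> \<le> c * (real k * sqrt (2 * ln (real k))) + real k + real (n - k\<^sup>2)"
            using empF_increment[OF n(1) F01[of m], of X \<omega> m] by simp
          also have "real (n - k\<^sup>2) \<le> 2 * real k"
          proof -
            have "n - k\<^sup>2 \<le> 2 * k" using n by (simp add: power2_eq_square)
            then show ?thesis by (metis of_nat_le_iff of_nat_mult of_nat_numeral)
          qed
          also have "c * (real k * sqrt (2 * ln (real k))) + real k + 2 * real k \<le> C * (real k * sqrt (2 * ln (real k)))"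
            using mult_left_mono[OF elim(2), of "real k"] by (simp add: algebra_simps)
          also note main
          also have "C * sqrt (real n * ln (real n)) = real n * (C * sqrt (ln (real n) / real n))"
            using \<open>0 < n\<close> by (simp add: real_sqrt_mult real_sqrt_divide field_simps)
          finally show "\<bar>empF X n \<omega> m - F m\<bar> \<le> C * sqrt (ln (real n) / real n)"
            using \<open>0 < n\<close> by simp
        qed simp
      qed
    qed
    then obtain K where K: "\<And>k n. K \<le> k \<Longrightarrow> k\<^sup>2 \<le> n \<Longrightarrow> n < (Suc k)\<^sup>2 \<Longrightarrow> dKS (empF X n \<omega>) F \<le> C * sqrt (ln (real n) / real n)"
      unfolding eventually_sequentially by blast
    show ?case
      unfolding eventually_sequentially
    proof (intro exI[of _ "K\<^sup>2"] allI impI)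
      fix n assume "K\<^sup>2 \<le> n"
      \<comment> \<open>Every n lies in the block of its integer square root.\<close>
      then have "K \<le> floor_sqrt n" by (simp add: le_floor_sqrt_iff)
      then show "dKS (empF X n \<omega>) F \<le> C * sqrt (ln (real n) / real n)"
        by (rule K) (simp_all add: Suc_floor_sqrt_power2_gt)
    qed
  qed
qed

section \<open>The Poisson-Gamma model and consistency of the estimator\<close>

lemma poisson_gamma_integral:
  assumes "0 < \<kappa>" "0 < l"
  shows "(\<integral>\<theta>. gamma_dens \<kappa> l \<theta> * (exp (- \<theta>) * \<theta> ^ x / fact x) \<partial>lborel) = nb \<kappa> x l"
proof (subst integral_eq_nn_integral)
  show "AE \<theta> in lborel. 0 \<le> gamma_dens \<kappa> l \<theta> * (exp (- \<theta>) * \<theta> ^ x / fact x)"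
    using assms by (intro always_eventually) (auto simp: gamma_dens_def[of _ _ \<theta> for \<theta>] less_imp_le Gamma_real_pos)
  show "enn2real (\<integral>\<^sup>+ \<theta>. ennreal (gamma_dens \<kappa> l \<theta> * (exp (- \<theta>) * \<theta> ^ x / fact x)) \<partial>lborel) = nb \<kappa> x l"
    using nn_integral_gamma_dens[OF assms, of 1 x] nb_nonneg[OF assms, of x] by (simp add: nb_def)
qed auto

theorem theorem5p2:
  fixes M :: "'a measure"
    and Hs :: "real measure" and \<kappa>s :: real
    and lam th :: "nat \<Rightarrow> 'a \<Rightarrow> real" and X :: "nat \<Rightarrow> 'a \<Rightarrow> nat"
  assumes "prob_space M"
    and "0 < \<kappa>s"
    and "Hs \<in> Ppos"
    and "\<And>i. lam i \<in> borel_measurable M"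
    and "\<And>i. th i \<in> borel_measurable M"
    and "\<And>i. X i \<in> measurable M (count_space UNIV)"
    and "prob_space.indep_vars M (\<lambda>i. borel \<Otimes>\<^sub>M borel \<Otimes>\<^sub>M count_space UNIV)
           (\<lambda>i \<omega>. (lam i \<omega>, th i \<omega>, X i \<omega>)) UNIV"
    and "\<And>i A B x. A \<in> sets borel \<Longrightarrow> B \<in> sets borel \<Longrightarrow>
           measure M {\<omega>\<in>space M. lam i \<omega> \<in> A \<and> th i \<omega> \<in> B \<and> X i \<omega> = x} =
           (\<integral>l. indicator A l *
              (\<integral>\<theta>. indicator B \<theta> * gamma_dens \<kappa>s l \<theta> * (exp (- \<theta>) * \<theta> ^ x / fact x) \<partial>lborel) \<partial>Hs)"
  shows "(\<forall>\<eta> :: nat \<Rightarrow> real.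
            (\<forall>n. 0 < \<eta> n) \<longrightarrow> \<eta> \<longlonglongrightarrow> 0 \<longrightarrow>
            (AE \<omega> in M. eventually (\<lambda>n. dKS (empF X n \<omega>)
                  (\<lambda>m. measure M {\<omega>'\<in>space M. X 0 \<omega>' \<le> m}) \<le> \<eta> n) sequentially) \<longrightarrow>
            (AE \<omega> in M. (\<lambda>n. kappa_hat \<eta> X n \<omega>) \<longlonglongrightarrow> kappa0 Hs \<kappa>s))
       \<and> (\<forall>C :: real. C > 1 / sqrt 2 \<longrightarrow>
            (AE \<omega> in M. (\<lambda>n. kappa_hat (\<lambda>n. C * sqrt (ln (real n) / real n)) X n \<omega>)
                \<longlonglongrightarrow> kappa0 Hs \<kappa>s))"
proof -
  interpret prob_space M by fact
  note X[measurable] = assms(6)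
  \<comment> \<open>Taking both Borel sets to be the whole line in the joint law leaves the marginal
    law of the count.\<close>
  have pmf: "prob {\<omega> \<in> space M. X i \<omega> = x} = fmix Hs \<kappa>s x" for i x
  proof -
    have "prob {\<omega> \<in> space M. X i \<omega> = x} =
        (\<integral>l. (\<integral>\<theta>. gamma_dens \<kappa>s l \<theta> * (exp (- \<theta>) * \<theta> ^ x / fact x) \<partial>lborel) \<partial>Hs)"
      using assms(8)[of UNIV UNIV i x] by simp
    also have "\<dots> = fmix Hs \<kappa>s x"
      unfolding fmix_nb
    proof (rule integral_cong_AE)
      show "AE l in Hs. (\<integral>\<theta>. gamma_dens \<kappa>s l \<theta> * (exp (- \<theta>) * \<theta> ^ x / fact x) \<partial>lborel) = nb \<kappa>s x l"
        using PposD(3)[OF assms(3)] by (rule eventually_mono) (rule poisson_gamma_integral[OF assms(2)])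
    qed (unfold measurable_cong_sets[OF PposD(2)[OF assms(3)] refl], measurable)
    finally show ?thesis .
  qed
  have cdf: "prob {\<omega> \<in> space M. X i \<omega> \<le> m} = Fmix Hs \<kappa>s m" for i m
  proof -
    have "{\<omega> \<in> space M. X i \<omega> \<le> m} = (\<Union>x\<in>{..m}. {\<omega> \<in> space M. X i \<omega> = x})" by auto
    also have "prob \<dots> = (\<Sum>x\<le>m. prob {\<omega> \<in> space M. X i \<omega> = x})"
      by (rule finite_measure_finite_Union) (auto simp: disjoint_family_on_def)
    finally show ?thesis by (simp add: pmf Fmix_def)
  qed
  have ind: "indep_vars (\<lambda>_. count_space UNIV) X UNIV"
    using indep_vars_compose2[OF assms(7), of "\<lambda>_ (a, b, c). c" "\<lambda>_. count_space UNIV"] by simp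
  have cons: "AE \<omega> in M. (\<lambda>n. kappa_hat \<eta> X n \<omega>) \<longlonglongrightarrow> kappa0 Hs \<kappa>s"
    if \<eta>: "\<eta> \<longlonglongrightarrow> 0" "eventually (\<lambda>n. 0 < \<eta> n) sequentially"
      and close: "AE \<omega> in M. eventually (\<lambda>n. dKS (empF X n \<omega>) (Fmix Hs \<kappa>s) \<le> \<eta> n) sequentially"
    for \<eta>
    using close
  proof (rule eventually_mono)
    fix \<omega> assume "eventually (\<lambda>n. dKS (empF X n \<omega>) (Fmix Hs \<kappa>s) \<le> \<eta> n) sequentially"
    then show "(\<lambda>n. kappa_hat \<eta> X n \<omega>) \<longlonglongrightarrow> kappa0 Hs \<kappa>s"
      unfolding kappa_hat_def by (intro Inf_delta_n_tendsto assms(2,3) empF_bounds \<eta>)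
  qed
  have "AE \<omega> in M. (\<lambda>n. kappa_hat (\<lambda>n. C * sqrt (ln (real n) / real n)) X n \<omega>) \<longlonglongrightarrow> kappa0 Hs \<kappa>s"
    if C: "1 / sqrt 2 < C" for C
  proof (rule cons)
    have "0 < 1 / sqrt (2::real)" by simp
    then have C0: "0 < C" using C by linarith
    show "(\<lambda>n. C * sqrt (ln (real n) / real n)) \<longlonglongrightarrow> 0" by real_asymp
    \<comment> \<open>The rate vanishes at n = 0 and n = 1, so positivity holds only from n = 2
      on.\<close>
    show "eventually (\<lambda>n. 0 < C * sqrt (ln (real n) / real n)) sequentially"
      using eventually_gt_at_top[of 1] by eventually_elim (use C0 in simp)
    show "AE \<omega> in M. eventually (\<lambda>n. dKS (empF X n \<omega>) (Fmix Hs \<kappa>s) \<le> C * sqrt (ln (real n) / real n)) sequentially"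
      by (rule empF_deviation[OF X ind cdf C])
  qed
  then show ?thesis using cons by (simp add: cdf)
qed

end
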